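(* Let $m=2m_0$ be even, $n\ge2$, $\mathcal{H}\in\operatorname{H}^m(\mathbb{C}^n)$ with associated vector $h=(h_0,\dots,h_d)$, $d=(n-1)m$, $s=d/2$, and $r=\operatorname{rank}C_{d-s,s}(h)$. If $r<s+1$, let $0\ne(f_0,\dots,f_r)\in\ker C_{d-r,r}(h)$ (unique up to scaling) and $f(x,y)=f_0x^r+f_1x^{r-1}y+\cdots+f_ry^r$. (i) If $r=s+1$, or if $r<s+1$ and $f$ has no multiple roots, then $\operatorname{rank}_V(\mathcal{H})=\operatorname{rank}_S(\mathcal{H})=\operatorname{rank}(\mathcal{H})=\underline{\operatorname{rank}}_V(\mathcal{H})=\underline{\operatorname{rank}}_S(\mathcal{H})=\underline{\operatorname{rank}}(\mathcal{H})=r.$ (ii) If $r<s+1$ and $f$ has a multiple root, then $d-r+2=\operatorname{rank}_V(\mathcal{H})\ge\operatorname{rank}_S(\mathcal{H})\ge\underline{\operatorname{rank}}_V(\mathcal{H})=\underline{\operatorname{rank}}_S(\mathcal{H})=\underline{\operatorname{rank}}(\mathcal{H})=r.$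
   Context: A tensor $\mathcal{H}\in\operatorname{T}^m(\mathbb{C}^n)$ is Hankel if there is a vector $h=(h_0,\dots,h_{(n-1)m})$ (associated vector) with $\mathcal{H}_{i_1\dots i_m}=h_{i_1+\cdots+i_m-m}$; $\operatorname{H}^m(\mathbb{C}^n)$ is the space of such tensors. $C_{d-r,r}(h)$ is the $(d-r+1)\times(r+1)$ matrix with $(i,j)$ entry $h_{i+j}$. Ranks: cp rank $\operatorname{rank}(\mathcal{A})$ = least $r$ with $\mathcal{A}=\sum_{i=1}^r u_{i,1}\otimes\cdots\otimes u_{i,m}$; border rank $\underline{\operatorname{rank}}(\mathcal{A})$ = least $r$ such that $\mathcal{A}$ is a limit of such sums of $r$ terms; symmetric rank $\operatorname{rank}_S$ and symmetric border rank $\underline{\operatorname{rank}}_S$ are defined the same way with terms $u_i^{\otimes m}$; Vandermonde rank $\operatorname{rank}_V(\mathcal{H})$ = least $r$ with $\mathcal{H}=\sum_{i=1}^r(a_i^{n-1},a_i^{n-2}b_i,\dots,b_i^{n-1})^{\otimes m}$, $a_i,b_i\in\mathbb{C}$; Vandermonde border rank $\underline{\operatorname{rank}}_V(\mathcal{H})$ = least $r$ such that $\mathcal{H}$ is a limit of Hankel tensors of Vandermonde rank at most $r$. *)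

theory Defs
  imports Complex_Main "HOL-Library.Extended_Nat"
    "Jordan_Normal_Form.DL_Rank" "Jordan_Normal_Form.Matrix_Kernel"
begin

text \<open>Tensors in T^m(C^n) are modelled as functions on index lists; only index
  lists of length m with entries in {0..<n} (0-based) are meaningful.\<close>

type_synonym tensor = "nat list \<Rightarrow> complex"

definition valid_idx :: "nat \<Rightarrow> nat \<Rightarrow> nat list set" where
  "valid_idx m n = {is. length is = m \<and> set is \<subseteq> {..<n}}"

text \<open>Hankel tensor with associated vector h = (h_0,...,h_{(n-1)m}) (0-based indices,
  so i_1+...+i_m-m becomes the plain sum of the 0-based indices).\<close>
definition is_hankel_with :: "nat \<Rightarrow> nat \<Rightarrow> tensor \<Rightarrow> (nat \<Rightarrow> complex) \<Rightarrow> bool" where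
  "is_hankel_with m n H h \<longleftrightarrow> (\<forall>is\<in>valid_idx m n. H is = h (sum_list is))"

definition cp_decomp :: "nat \<Rightarrow> nat \<Rightarrow> nat \<Rightarrow> tensor \<Rightarrow> bool" where
  "cp_decomp m n r A \<longleftrightarrow> (\<exists>U :: nat \<Rightarrow> nat \<Rightarrow> nat \<Rightarrow> complex.
      \<forall>is\<in>valid_idx m n. A is = (\<Sum>k<r. \<Prod>j<m. U k j (is ! j)))"

definition sym_decomp :: "nat \<Rightarrow> nat \<Rightarrow> nat \<Rightarrow> tensor \<Rightarrow> bool" where
  "sym_decomp m n r A \<longleftrightarrow> (\<exists>u :: nat \<Rightarrow> nat \<Rightarrow> complex.
      \<forall>is\<in>valid_idx m n. A is = (\<Sum>k<r. \<Prod>j<m. u k (is ! j)))"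

text \<open>Vandermonde vector (a^{n-1}, a^{n-2} b, ..., b^{n-1}); its i-th entry is a^(n-1-i) b^i.\<close>
definition vand_decomp :: "nat \<Rightarrow> nat \<Rightarrow> nat \<Rightarrow> tensor \<Rightarrow> bool" where
  "vand_decomp m n r A \<longleftrightarrow> (\<exists>a b :: nat \<Rightarrow> complex.
      \<forall>is\<in>valid_idx m n. A is = (\<Sum>k<r. \<Prod>j<m. a k ^ (n - 1 - is ! j) * b k ^ (is ! j)))"

text \<open>A is a limit (entrywise, equivalently in any norm since the index set is finite)
  of tensors satisfying P.\<close>
definition limit_of :: "nat \<Rightarrow> nat \<Rightarrow> (tensor \<Rightarrow> bool) \<Rightarrow> tensor \<Rightarrow> bool" where
  "limit_of m n P A \<longleftrightarrow> (\<exists>X :: nat \<Rightarrow> tensor. (\<forall>t. P (X t)) \<and>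
      (\<forall>is\<in>valid_idx m n. (\<lambda>t. X t is) \<longlonglongrightarrow> A is))"

text \<open>Ranks take values in nat \<union> {\<infinity>} (infimum of the empty set is \<infinity>).\<close>
definition least_rank :: "(nat \<Rightarrow> bool) \<Rightarrow> enat" where
  "least_rank P = (INF r\<in>{r. P r}. enat r)"

definition cp_rank :: "nat \<Rightarrow> nat \<Rightarrow> tensor \<Rightarrow> enat" where
  "cp_rank m n A = least_rank (\<lambda>r. cp_decomp m n r A)"

definition border_rank :: "nat \<Rightarrow> nat \<Rightarrow> tensor \<Rightarrow> enat" where
  "border_rank m n A = least_rank (\<lambda>r. limit_of m n (cp_decomp m n r) A)"

definition sym_rank :: "nat \<Rightarrow> nat \<Rightarrow> tensor \<Rightarrow> enat" where
  "sym_rank m n A = least_rank (\<lambda>r. sym_decomp m n r A)"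

definition sym_border_rank :: "nat \<Rightarrow> nat \<Rightarrow> tensor \<Rightarrow> enat" where
  "sym_border_rank m n A = least_rank (\<lambda>r. limit_of m n (sym_decomp m n r) A)"

definition vand_rank :: "nat \<Rightarrow> nat \<Rightarrow> tensor \<Rightarrow> enat" where
  "vand_rank m n A = least_rank (\<lambda>r. vand_decomp m n r A)"

text \<open>Limit of Hankel tensors of Vandermonde rank at most r (sums of r Vandermonde
  terms, allowing zero terms, are exactly those).\<close>
definition vand_border_rank :: "nat \<Rightarrow> nat \<Rightarrow> tensor \<Rightarrow> enat" where
  "vand_border_rank m n A = least_rank (\<lambda>r. limit_of m n
      (\<lambda>X. (\<exists>g. is_hankel_with m n X g) \<and> vand_rank m n X \<le> enat r) A)"

definition catalecticant :: "nat \<Rightarrow> nat \<Rightarrow> (nat \<Rightarrow> complex) \<Rightarrow> complex mat" where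
  "catalecticant p q h = mat (p + 1) (q + 1) (\<lambda>(i, j). h (i + j))"

definition mat_rank :: "complex mat \<Rightarrow> nat" where
  "mat_rank A = vec_space.rank (dim_row A) A"

definition binary_form :: "nat \<Rightarrow> (nat \<Rightarrow> complex) \<Rightarrow> complex \<Rightarrow> complex \<Rightarrow> complex" where
  "binary_form r c x y = (\<Sum>j\<le>r. c j * x ^ (r - j) * y ^ j)"

text \<open>f has a multiple root: the square of some nonzero linear form (\<beta> x - \<alpha> y)
  divides f, i.e. the root [\<alpha>:\<beta>] of f in P^1 has multiplicity \<ge> 2.\<close>
definition has_multiple_root :: "nat \<Rightarrow> (nat \<Rightarrow> complex) \<Rightarrow> bool" where
  "has_multiple_root r c \<longleftrightarrow> (\<exists>\<alpha> \<beta> :: complex. (\<alpha>, \<beta>) \<noteq> (0, 0) \<and>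
     (\<exists>g :: nat \<Rightarrow> complex. \<forall>x y. binary_form r c x y =
        (\<beta> * x - \<alpha> * y)^2 * binary_form (r - 2) g x y))"

end

theory Submission
  imports Defs "HOL-Computational_Algebra.Fundamental_Theorem_Algebra"
begin

text \<open>A Vandermonde decomposition of the Hankel tensor is an expression of the associated vector as
  \<open>h i = (\<Sum>k<R. a k ^ (d - i) * b k ^ i)\<close>. Regard \<open>h\<close> as the functional \<open>X ^ i \<mapsto> h i\<close>; a squarefree form
  annihilating it yields such a decomposition at its roots (Sylvester).

  If the \<open>k \<times> k\<close> Hankel matrix of \<open>h\<close> is nonsingular, letting the next entry of \<open>h\<close> vary gives a pencil
  \<open>f + t g\<close> of annihilators of degree \<open>k\<close> with coprime \<open>f\<close>, \<open>g\<close>, and the Wronskian shows that almost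
  all members are squarefree. This settles full rank. If \<open>r \<le> s\<close>, a coordinate change makes the
  annihilator \<open>f\<close> of exact degree \<open>r\<close>. Extending \<open>h\<close> past \<open>h d\<close> so that the recurrence given by \<open>f\<close>
  breaks makes the Hankel matrix of size \<open>d - r + 2\<close> nonsingular, whence the Vandermonde rank is at most
  \<open>d - r + 2\<close>; solving the recurrences of the forms \<open>f + t\<close>, which are squarefree for almost all \<open>t\<close>, and
  letting \<open>t\<close> tend to 0 bounds the border rank by \<open>r\<close>. Conversely, a decomposition with at
  most \<open>d - r + 1\<close> terms forces \<open>f\<close> to vanish at all its nodes; so does \<open>f\<close> with one factor of a double
  root removed, which would annihilate \<open>h\<close> in degree \<open>r - 1\<close>. All border ranks are at least \<open>r\<close> by
  flattening and continuity of a nonzero minor.\<close>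

section \<open>Linear functionals on polynomials and pencils\<close>

definition seq_functional :: "(nat \<Rightarrow> complex) \<Rightarrow> complex poly \<Rightarrow> complex" where
  "seq_functional h p = (\<Sum>i\<le>degree p. coeff p i * h i)"

lemma seq_functional_altdef:
  assumes "degree p \<le> N"
  shows "seq_functional h p = (\<Sum>i\<le>N. coeff p i * h i)"
  unfolding seq_functional_def
  by (rule sum.mono_neutral_left) (use assms in \<open>auto simp: coeff_eq_0\<close>)

lemma seq_functional_0 [simp]: "seq_functional h 0 = 0"
  by (simp add: seq_functional_def)

lemma seq_functional_add: "seq_functional h (p + q) = seq_functional h p + seq_functional h q"
proof -
  let ?N = "max (degree p) (degree q)"
  have "degree (p + q) \<le> ?N" by (rule degree_add_le_max)
  then show ?thesis
    by (simp add: seq_functional_altdef[of _ ?N] distrib_right sum.distrib)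
qed

lemma seq_functional_smult: "seq_functional h (smult c p) = c * seq_functional h p"
  by (simp add: seq_functional_altdef[of _ "degree p"] sum_distrib_left mult.assoc)

lemma seq_functional_diff: "seq_functional h (p - q) = seq_functional h p - seq_functional h q"
  using seq_functional_add[of h p "smult (-1) q"] seq_functional_smult[of h "-1" q] by simp

lemma seq_functional_sum: "seq_functional h (sum f A) = (\<Sum>x\<in>A. seq_functional h (f x))"
  by (induction A rule: infinite_finite_induct) (auto simp: seq_functional_add)

lemma seq_functional_monom: "seq_functional h (monom c i) = c * h i"
  by (simp add: seq_functional_altdef[of _ i] degree_monom_le if_distrib[of "\<lambda>x. x * _"] cong: if_cong)

lemma seq_functional_cong:
  assumes "degree p \<le> N" "\<And>i. i \<le> N \<Longrightarrow> h i = h' i"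
  shows "seq_functional h p = seq_functional h' p"
  using assms by (simp add: seq_functional_altdef[of p N])

text \<open>A binary form of degree \<open>k\<close> is represented by a polynomial of degree at most \<open>k\<close>, the defect being
  the multiplicity of the root at infinity. That it annihilates \<open>h\<close> means that its coefficients lie in
  the kernel of the catalecticant \<open>C\<^bsub>N-k,k\<^esub>(h)\<close>.\<close>
definition annihilates :: "complex poly \<Rightarrow> (nat \<Rightarrow> complex) \<Rightarrow> nat \<Rightarrow> nat \<Rightarrow> bool" where
  "annihilates f h k N \<longleftrightarrow> (\<forall>q. degree q + k \<le> N \<longrightarrow> seq_functional h (f * q) = 0)"

text \<open>The powers of a polynomial of degree 1 form a basis compatible with degree: subtracting
  a multiple of \<open>p ^ degree q\<close> lowers the degree of \<open>q\<close>. Besides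
  monomials, the powers of \<open>X - c\<close> are needed, for the transport along the coordinate
  change.\<close>

lemma annihilatesI:
  assumes "\<And>i. i + k \<le> N \<Longrightarrow> seq_functional h (f * p ^ i) = 0" and "degree p = 1"
  shows "annihilates f h k N"
  unfolding annihilates_def
proof (intro allI impI)
  fix q :: "complex poly"
  show "degree q + k \<le> N \<Longrightarrow> seq_functional h (f * q) = 0"
  proof (induction "degree q" arbitrary: q rule: less_induct)
    case less
    define c where "c = lead_coeff q / lead_coeff (p ^ degree q)"
    define q' where "q' = q - smult c (p ^ degree q)"
    have p: "p \<noteq> 0" using assms(2) by auto
    have deg: "degree (p ^ degree q) = degree q" using assms(2) by (simp add: degree_power_eq p)
    have lc: "lead_coeff (p ^ degree q) \<noteq> 0" using p by simp
    have top: "coeff q' (degree q) = 0"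
      using lc deg by (simp add: q'_def c_def)
    have le: "degree q' \<le> degree q"
      unfolding q'_def by (rule degree_diff_le) (use deg in auto)
    have q: "seq_functional h (f * q) = seq_functional h (f * q') + c * seq_functional h (f * p ^ degree q)"
      by (simp add: q'_def algebra_simps seq_functional_diff seq_functional_smult)
    have "seq_functional h (f * q') = 0"
    proof (cases "q' = 0")
      case False
      then have "degree q' < degree q" using top le
        by (metis leading_coeff_0_iff le_neq_implies_less)
      then show ?thesis using less by auto
    qed auto
    then show ?case using q assms(1) less.prems by simp
  qed
qed

text \<open>A multiple root \<open>x\<close> of \<open>p + t g\<close> is a zero of the Wronskian
  \<open>W\<close>, and it determines \<open>t = - p x / g x\<close>, since \<open>g x\<close>
  cannot vanish as well. \<open>W\<close> is nonzero because the leading coefficients of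
  \<open>p g'\<close> and \<open>p' g\<close> are the same product multiplied by the different
  integers \<open>degree g\<close> and \<open>degree p\<close>.\<close>

lemma finite_not_rsquarefree_pencil:
  fixes p g :: "complex poly"
  assumes deg: "degree g < degree p" and coprime: "\<And>x. poly p x = 0 \<Longrightarrow> poly g x \<noteq> 0"
  shows "finite {t. \<not> rsquarefree (p + smult t g)}"
proof -
  define W where "W = p * pderiv g - pderiv p * g"
  have "W \<noteq> 0"
  proof
    assume "W = 0"
    then have eq: "p * pderiv g = pderiv p * g" by (simp add: W_def)
    have p: "pderiv p \<noteq> 0" using deg by (simp add: pderiv_eq_0_iff)
    have g0: "g \<noteq> 0"
    proof
      assume "g = 0"
      moreover obtain x where "poly p x = 0"
        using deg fundamental_theorem_of_algebra[of p] constant_degree[of p] by auto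
      ultimately show False using coprime by auto
    qed
    have "degree g \<noteq> 0"
    proof
      assume "degree g = 0"
      then have "pderiv g = 0" by (simp add: pderiv_eq_0_iff)
      then show False using eq p g0 by auto
    qed
    then have lg: "lead_coeff (pderiv g) = of_nat (degree g) * lead_coeff g"
      by (simp add: degree_pderiv coeff_pderiv)
    have lp: "lead_coeff (pderiv p) = of_nat (degree p) * lead_coeff p"
      using deg by (simp add: degree_pderiv coeff_pderiv)
    have "lead_coeff p * lead_coeff (pderiv g) = lead_coeff (pderiv p) * lead_coeff g"
      using arg_cong[OF eq, of lead_coeff] by (simp add: lead_coeff_mult)
    then have "of_nat (degree g) = (of_nat (degree p) :: complex)"
      unfolding lg lp using g0 deg by auto
    then show False using deg by (simp only: of_nat_eq_iff)
  qed
  then have fin: "finite {x. poly W x = 0}" by (rule poly_roots_finite)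
  have "{t. \<not> rsquarefree (p + smult t g)} \<subseteq> (\<lambda>x. - poly p x / poly g x) ` {x. poly W x = 0}"
  proof
    fix t assume "t \<in> {t. \<not> rsquarefree (p + smult t g)}"
    then obtain x where x: "poly p x + t * poly g x = 0" "poly (pderiv p) x + t * poly (pderiv g) x = 0"
      by (auto simp: rsquarefree_roots pderiv_add pderiv_smult)
    then have "poly p x = - t * poly g x" "poly (pderiv p) x = - t * poly (pderiv g) x"
      by (simp_all add: add_eq_0_iff2)
    then have "poly W x = 0" by (simp add: W_def)
    moreover have "poly g x \<noteq> 0" using x(1) coprime[of x] by auto
    then have "t = - poly p x / poly g x" using x(1) by (simp add: field_simps add_eq_0_iff)
    ultimately show "t \<in> (\<lambda>x. - poly p x / poly g x) ` {x. poly W x = 0}" by auto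
  qed
  then show ?thesis using fin finite_surj by blast
qed

section \<open>Quadrature at the roots of a squarefree annihilator\<close>

lemma rsquarefree_card_roots:
  fixes f :: "complex poly"
  assumes "rsquarefree f"
  shows "card {x. poly f x = 0} = degree f"
proof -
  have "f \<noteq> 0" using assms by (simp add: rsquarefree_def)
  have "degree (smult (lead_coeff f) (\<Prod>z | poly f z = 0. [:-z, 1:])) = card {x. poly f x = 0}"
    using \<open>f \<noteq> 0\<close> by (simp add: degree_prod_eq_sum_degree)
  then show ?thesis using complex_poly_decompose_rsquarefree[OF assms] by simp
qed

lemma degree_eq_degree_add_degree_div:
  fixes p f :: "'a::field poly"
  assumes "f \<noteq> 0" "p div f \<noteq> 0"
  shows "degree p = degree f + degree (p div f)"
proof -
  have "degree (p div f * f + p mod f) = degree (p div f * f)"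
  proof (cases "p mod f = 0")
    case False
    then have "degree (p mod f) < degree f" using degree_mod_less[of f p] assms(1) by auto
    then show ?thesis using assms by (intro degree_add_eq_left) (simp add: degree_mult_eq)
  qed simp
  then show ?thesis using assms by (simp add: degree_mult_eq)
qed

text \<open>Reducing \<open>p\<close> modulo \<open>f\<close> does not change the value of the
  functional. As \<open>f\<close> has \<open>degree f\<close> distinct roots, the remainder equals
  its Lagrange interpolant at them; the weight of a root is the value of the functional on its
  Lagrange basis polynomial \<open>l x\<close>.\<close>

lemma annihilator_quadrature:
  assumes sf: "rsquarefree f" and ann: "annihilates f h (degree f) N"
  shows "\<exists>w. \<forall>p. degree p \<le> N \<longrightarrow> seq_functional h p = (\<Sum>x | poly f x = 0. w x * poly p x)"
proof -
  define S where "S = {x. poly f x = 0}"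
  define l where "l x = (\<Prod>y\<in>S - {x}. smult (1 / (x - y)) [:-y, 1:])" for x
  have f0: "f \<noteq> 0" using sf by (simp add: rsquarefree_def)
  then have fin: "finite S" unfolding S_def by (rule poly_roots_finite)
  have card: "card S = degree f" unfolding S_def using sf by (rule rsquarefree_card_roots)
  have deg_l: "degree (l x) < degree f" if "x \<in> S" for x
  proof -
    have "degree (l x) \<le> (\<Sum>y\<in>S - {x}. degree (smult (1 / (x - y)) [:-y, 1:]))"
      unfolding l_def by (rule order_trans[OF degree_prod_sum_le]) (simp_all only: o_def finite_Diff[OF fin] order_refl)
    also have "\<dots> \<le> (\<Sum>y\<in>S - {x}. 1)" by (intro sum_mono) auto
    also have "\<dots> < card S" using card_Diff1_less[OF fin that] by simp
    finally show ?thesis using card by simp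
  qed
  have l_same: "poly (l x) x = 1" if "x \<in> S" for x
    unfolding l_def poly_prod by (intro prod.neutral) (auto simp flip: diff_divide_distrib)
  have l_other: "poly (l x) y = 0" if "y \<in> S" "x \<noteq> y" for x y
    unfolding l_def poly_prod using that fin by auto
  have "seq_functional h p = (\<Sum>x\<in>S. seq_functional h (l x) * poly p x)" if p: "degree p \<le> N" for p
  proof -
    define q where "q = p div f"
    define r where "r = p mod f"
    have pq: "p = f * q + r" by (simp add: q_def r_def)
    have r: "r = (\<Sum>x\<in>S. smult (poly p x) (l x))"
    proof (cases "degree f = 0")
      case True
      then have "S = {}" using card fin by auto
      moreover have "r = 0" using True f0 unfolding r_def
        by (metis degree_mod_less less_nat_zero_code)
      ultimately show ?thesis by simp
    next
      case False
      show ?thesis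
      proof (rule poly_eqI_degree[of S])
        fix y assume y: "y \<in> S"
        have "poly (\<Sum>x\<in>S. smult (poly p x) (l x)) y = (\<Sum>x\<in>S. if x = y then poly p x else 0)"
          unfolding poly_sum by (intro sum.cong) (auto simp: l_same l_other y)
        also have "\<dots> = poly p y" using y fin by simp
        also have "\<dots> = poly r y" using y by (simp add: pq S_def)
        finally show "poly r y = poly (\<Sum>x\<in>S. smult (poly p x) (l x)) y" by simp
      next
        show "degree r < card S" unfolding card r_def
          using degree_mod_less[of f p] f0 False by auto
        have "degree (\<Sum>x\<in>S. smult (poly p x) (l x)) \<le> degree f - 1"
        proof (rule degree_sum_le[OF fin])
          fix x assume "x \<in> S"
          then show "degree (smult (poly p x) (l x)) \<le> degree f - 1" 
            using deg_l[of x] by (intro order_trans[OF degree_smult_le]) simp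
        qed
        then show "degree (\<Sum>x\<in>S. smult (poly p x) (l x)) < card S"
          unfolding card using False by linarith
      qed
    qed
    have "seq_functional h (f * q) = 0"
    proof (cases "q = 0")
      case False
      then have "degree p = degree f + degree q"
        unfolding q_def by (intro degree_eq_degree_add_degree_div f0)
      then show ?thesis using ann p unfolding annihilates_def by simp
    qed auto
    then have "seq_functional h p = seq_functional h r"
      unfolding pq by (simp add: seq_functional_add)
    then show ?thesis
      unfolding r seq_functional_sum seq_functional_smult by (simp add: mult.commute)
  qed
  then show ?thesis unfolding S_def by (intro exI allI impI)
qed

section \<open>Nonsingular Hankel matrices and their pencils of annihilators\<close>

definition hankel_nonsingular :: "nat \<Rightarrow> (nat \<Rightarrow> complex) \<Rightarrow> bool" where
  "hankel_nonsingular k h \<longleftrightarrow>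
     (\<forall>v. degree v < k \<longrightarrow> (\<forall>q. degree q < k \<longrightarrow> seq_functional h (v * q) = 0) \<longrightarrow> v = 0)"

lemma seq_functional_mult_monom:
  assumes "degree v < k"
  shows "seq_functional h (v * monom 1 i) = (\<Sum>j<k. coeff v j * h (i + j))"
proof -
  have "v * monom 1 i = (\<Sum>j<k. monom (coeff v j) (i + j))"
  proof -
    have "v = (\<Sum>j\<le>k - 1. monom (coeff v j) j)"
      using assms by (intro poly_as_sum_of_monoms'[symmetric]) simp
    also have "{..k - 1} = {..<k}" using assms by auto
    finally have "v * monom 1 i = (\<Sum>j<k. monom (coeff v j) j) * monom 1 i" by simp
    then show ?thesis by (simp add: sum_distrib_right mult_monom add.commute)
  qed
  then show ?thesis by (simp add: seq_functional_sum seq_functional_monom)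
qed

text \<open>A kernel vector of the matrix is the coefficient vector of a polynomial in the radical
  of the bilinear form \<open>h (v q)\<close>. For \<open>k = 0\<close> nonsingularity is vacuous
  and agrees with the empty determinant 1; this covers catalecticants of rank 0.\<close>

lemma det_hankel_nonzero:
  assumes "hankel_nonsingular k h"
  shows "det (mat k k (\<lambda>(i, j). h (i + j))) \<noteq> 0"
proof
  let ?A = "mat k k (\<lambda>(i, j). h (i + j))"
  assume "det ?A = 0"
  then obtain v where v: "v \<in> carrier_vec k" "v \<noteq> 0\<^sub>v k" "?A *\<^sub>v v = 0\<^sub>v k"
    using det_0_iff_vec_prod_zero_field[of ?A k] by auto
  define p where "p = (\<Sum>j<k. monom (v $ j) j)"
  have k: "k > 0" using v(1,2) by (cases k) auto
  have cp: "coeff p j = (if j < k then v $ j else 0)" for j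
    by (simp add: p_def coeff_sum)
  have deg: "degree p < k" using k by (intro degree_lessI) (auto simp: cp)
  have "seq_functional h (p * monom 1 i) = 0" if "i < k" for i
  proof -
    have "(\<Sum>j<k. h (i + j) * v $ j) = (?A *\<^sub>v v) $ i"
      using that v(1) by (auto simp: scalar_prod_def lessThan_atLeast0)
    then show ?thesis using that v
      by (simp add: seq_functional_mult_monom[OF deg] cp mult.commute)
  qed
  \<comment> \<open>With parameters 0 and \<open>k - 1\<close>, \<open>annihilates\<close> ranges
    over exactly the \<open>q\<close> of degree below \<open>k\<close>.\<close>
  then have "annihilates p h 0 (k - 1)"
    using k by (intro annihilatesI[of _ _ _ _ "monom 1 1"]) (auto simp: monom_power degree_monom_eq)
  then have "p = 0" using assms deg k unfolding hankel_nonsingular_def annihilates_def by auto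
  then have "v $ j = 0" if "j < k" for j using cp[of j] that by simp
  then show False using v(1,2) by auto
qed

lemma hankel_nonsingular_solve:
  assumes "hankel_nonsingular k h" "k > 0"
  shows "\<exists>v. degree v < k \<and> (\<forall>i<k. seq_functional h (v * monom 1 i) = b i)"
proof -
  let ?A = "mat k k (\<lambda>(i, j). h (i + j))"
  have "?A \<in> Units (ring_mat TYPE(complex) k ())"
    using det_hankel_nonzero[OF assms(1)] by (intro det_non_zero_imp_unit) auto
  then obtain B where B: "B \<in> carrier_mat k k" "?A * B = 1\<^sub>m k"
    unfolding Units_def ring_mat_def by auto
  define v where "v = B *\<^sub>v vec k b"
  have v: "v \<in> carrier_vec k" using B by (simp add: v_def)
  define p where "p = (\<Sum>j<k. monom (v $ j) j)"
  have cp: "coeff p j = (if j < k then v $ j else 0)" for j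
    by (simp add: p_def coeff_sum)
  have deg: "degree p < k" using assms(2) by (intro degree_lessI) (auto simp: cp)
  have Av: "?A *\<^sub>v v = vec k b"
  proof -
    have "?A *\<^sub>v v = (?A * B) *\<^sub>v vec k b" unfolding v_def
      by (rule assoc_mult_mat_vec[symmetric, of _ k k _ k]) (use B in auto)
    then show ?thesis by (simp add: B)
  qed
  have "seq_functional h (p * monom 1 i) = b i" if "i < k" for i
  proof -
    have "(\<Sum>j<k. h (i + j) * v $ j) = (?A *\<^sub>v v) $ i"
      using that v(1) by (auto simp: scalar_prod_def lessThan_atLeast0)
    then show ?thesis using that v
      by (simp add: seq_functional_mult_monom[OF deg] cp mult.commute Av)
  qed
  then show ?thesis using deg by blast
qed

text \<open>At a common root \<open>x\<close>, divide both polynomials by \<open>X - x\<close>. The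
  functionals \<open>h (f' q)\<close> and \<open>h (g' q)\<close> are then multiples
  \<open>b\<close> and \<open>a\<close> of evaluation at \<open>x\<close>, so
  \<open>a f' - b g'\<close> lies in the radical and vanishes. Its top coefficient gives
  \<open>a = 0\<close>; hence \<open>g'\<close> lies in the radical too, contradicting the
  normalisation of \<open>g\<close>.\<close>

lemma hankel_nonsingular_coprime:
  assumes ns: "hankel_nonsingular k h" and f: "lead_coeff f = 1" "degree f = k"
    and ann_f: "\<And>q. degree q < k \<Longrightarrow> seq_functional h (f * q) = 0"
    and g: "degree g < k" and ann_g: "\<And>q. degree q < k \<Longrightarrow> seq_functional h (g * q) = coeff q (k - 1)"
    and root: "poly f x = 0"
  shows "poly g x \<noteq> 0"
proof
  assume "poly g x = 0"
  have k: "k > 0" using g by simp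
  obtain f' where f': "f = [:-x, 1:] * f'" using root by (metis dvdE poly_eq_0_iff_dvd)
  obtain g' where g': "g = [:-x, 1:] * g'" using \<open>poly g x = 0\<close> by (metis dvdE poly_eq_0_iff_dvd)
  have f'0: "f' \<noteq> 0" using f f' by auto
  have "coeff (monom (1::complex) (k - 1)) (k - 1) = 1" by simp
  then have g'0: "g' \<noteq> 0" using ann_g[of "monom 1 (k - 1)"] k g'
    by (auto simp: degree_monom_eq)
  have deg_f': "degree f' = k - 1" using f(2) f'0 unfolding f' by (subst (asm) degree_mult_eq) auto
  have deg_g': "degree g' < k - 1" using g g'0 unfolding g' by (subst (asm) degree_mult_eq) auto
  have lead: "coeff f' (k - 1) = 1" 
    using f(1) unfolding f' lead_coeff_mult using deg_f' by simp
  \<comment> \<open>Modulo \<open>X - x\<close> the polynomial \<open>q\<close> reduces to the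
    constant \<open>poly q x\<close>.\<close>
  have eval: "seq_functional h (u * q) = poly q x * seq_functional h u"
    if u: "\<And>q. degree q < k - 1 \<Longrightarrow> seq_functional h ([:-x, 1:] * u * q) = 0" and q: "degree q < k" for u q
  proof -
    obtain q' where "q - [:poly q x:] = [:-x, 1:] * q'"
      by (metis dvdE poly_eq_0_iff_dvd poly_diff poly_const_conv right_minus_eq)
    then have q': "q = [:-x, 1:] * q' + [:poly q x:]" by (simp add: algebra_simps)
    have "seq_functional h ([:-x, 1:] * u * q') = 0"
    proof (cases "q' = 0")
      case False
      have "degree (q - [:poly q x:]) \<le> degree q" by (rule degree_diff_le) auto
      then have "degree ([:-x, 1:] * q') < k" 
        using q \<open>q - [:poly q x:] = [:-x, 1:] * q'\<close> by simp
      then have "degree q' < k - 1" using False by (subst (asm) degree_mult_eq) auto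
      then show ?thesis by (rule u)
    qed auto
    moreover have "u * q = [:-x, 1:] * u * q' + smult (poly q x) u"
      by (subst q') (simp add: algebra_simps)
    ultimately show ?thesis by (simp add: seq_functional_add seq_functional_smult)
  qed
  define a where "a = seq_functional h g'"
  define b where "b = seq_functional h f'"
  have ef: "seq_functional h (f' * q) = poly q x * b" if "degree q < k" for q
    unfolding b_def by (rule eval[OF _ that], subst f'[symmetric], rule ann_f) auto
  \<comment> \<open>In \<open>eval\<close> only \<open>q\<close> of degree below
    \<open>k - 1\<close> are tested, for which \<open>coeff q (k - 1)\<close> is 0.\<close>
  have eg: "seq_functional h (g' * q) = poly q x * a" if "degree q < k" for q
    unfolding a_def by (rule eval[OF _ that], subst g'[symmetric], subst ann_g) (auto simp: coeff_eq_0)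
  have "degree (smult a f' - smult b g') < k"
    using deg_f' deg_g' k by (intro degree_diff_less) (auto intro: le_less_trans[OF degree_smult_le])
  moreover have "seq_functional h ((smult a f' - smult b g') * q) = 0" if "degree q < k" for q
    by (simp add: left_diff_distrib seq_functional_diff seq_functional_smult ef eg that)
  ultimately have "smult a f' - smult b g' = 0"
    using ns unfolding hankel_nonsingular_def by blast
  \<comment> \<open>In degree \<open>k - 1\<close> only \<open>f'\<close> contributes, with
    coefficient 1.\<close>
  then have "coeff (smult a f' - smult b g') (k - 1) = 0" by simp
  then have "a = 0" using deg_g' lead by (simp add: coeff_eq_0)
  then have "g' = 0" using ns deg_g' eg unfolding hankel_nonsingular_def by simp
  then show False using g'0 by simp
qed

text \<open>All members of the pencil \<open>f + t g\<close> annihilate \<open>h\<close> up to index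
  \<open>2 * k - 2\<close>. As \<open>f\<close> and \<open>g\<close> are coprime, some member is
  squarefree, and its \<open>k\<close> roots are the nodes.\<close>

lemma hankel_nonsingular_nodes:
  assumes ns: "hankel_nonsingular k h" and k: "k > 0"
  shows "\<exists>S w. finite S \<and> card S = k \<and> (\<forall>i\<le>2 * k - 2. h i = (\<Sum>x\<in>S. w x * x ^ i))"
proof -
  \<comment> \<open>Chosen so that \<open>X ^ k - v\<close> is orthogonal to all polynomials of
    degree below \<open>k\<close>.\<close>
  obtain v where v: "degree v < k" "\<And>i. i < k \<Longrightarrow> seq_functional h (v * monom 1 i) = h (k + i)"
    using hankel_nonsingular_solve[OF assms, of "\<lambda>i. h (k + i)"] by blast
  \<comment> \<open>\<open>g\<close> is dual to \<open>X ^ (k - 1)\<close>: adding \<open>t\<close>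
    to \<open>h (2 * k - 1)\<close> would turn \<open>f\<close> into \<open>f - t g\<close>.\<close>
  obtain g where g: "degree g < k" 
      "\<And>i. i < k \<Longrightarrow> seq_functional h (g * monom 1 i) = (if i = k - 1 then 1 else 0)"
    using hankel_nonsingular_solve[OF assms, of "\<lambda>i. if i = k - 1 then 1 else 0"] by blast
  define f where "f = monom 1 k - v"
  have deg_f: "degree f = k" and lc_f: "lead_coeff f = 1"
  proof -
    have "degree (monom 1 k + - v) = degree (monom (1::complex) k)"
      using v(1) by (intro degree_add_eq_left) (simp add: degree_monom_eq)
    then show "degree f = k" by (simp add: f_def degree_monom_eq)
    then show "lead_coeff f = 1" using v(1) by (simp add: f_def coeff_eq_0)
  qed
  have expand: "seq_functional h (u * q) = (\<Sum>i<k. coeff q i * seq_functional h (u * monom 1 i))"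
    if "degree q < k" for u q
  proof -
    have "q = (\<Sum>i\<le>k - 1. monom (coeff q i) i)"
      using that by (intro poly_as_sum_of_monoms'[symmetric]) simp
    also have "{..k - 1} = {..<k}" using k by auto
    finally have "u * q = u * (\<Sum>i<k. monom (coeff q i) i)" by simp
    also have "\<dots> = (\<Sum>i<k. smult (coeff q i) (u * monom 1 i))"
      by (simp add: sum_distrib_left flip: mult_smult_right smult_monom[of _ 1, simplified])
        (simp add: smult_monom)
    finally show ?thesis by (simp add: seq_functional_sum seq_functional_smult)
  qed
  have ann_f: "seq_functional h (f * q) = 0" if "degree q < k" for q
    unfolding expand[OF that] f_def
    by (simp add: left_diff_distrib seq_functional_diff v(2) mult_monom seq_functional_monom)
  have ann_g: "seq_functional h (g * q) = coeff q (k - 1)" if "degree q < k" for q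
    unfolding expand[OF that] using k by (simp add: g(2) if_distrib[of "\<lambda>x. _ * x"] cong: if_cong)
  have "finite {t. \<not> rsquarefree (f + smult t g)}"
  proof (rule finite_not_rsquarefree_pencil)
    show "degree g < degree f" using g deg_f by simp
    show "poly g x \<noteq> 0" if "poly f x = 0" for x
      by (rule hankel_nonsingular_coprime[OF ns lc_f deg_f ann_f g(1) ann_g that])
  qed
  then obtain t where t: "rsquarefree (f + smult t g)"
    using infinite_UNIV_char_0[where 'a = complex] by (metis (mono_tags) UNIV_eq_I mem_Collect_eq)
  let ?f = "f + smult t g"
  have deg: "degree ?f = k"
    using deg_f g(1) by (subst degree_add_eq_left) (auto intro: le_less_trans[OF degree_smult_le])
  \<comment> \<open>Here \<open>q\<close> has degree at most \<open>k - 2\<close>, so the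
    contribution \<open>t * coeff q (k - 1)\<close> of \<open>g\<close> vanishes.\<close>
  have "annihilates ?f h (degree ?f) (2 * k - 2)"
    unfolding annihilates_def deg using k
    by (auto simp: distrib_right seq_functional_add seq_functional_smult ann_f ann_g coeff_eq_0)
  then obtain w where w: "\<And>p. degree p \<le> 2 * k - 2 \<Longrightarrow>
      seq_functional h p = (\<Sum>x | poly ?f x = 0. w x * poly p x)"
    using annihilator_quadrature[OF t] by blast
  have "h i = (\<Sum>x | poly ?f x = 0. w x * x ^ i)" if "i \<le> 2 * k - 2" for i
    using w[of "monom 1 i"] that by (simp add: degree_monom_eq seq_functional_monom poly_monom)
  moreover have "finite {x. poly ?f x = 0}" 
    using deg k by (intro poly_roots_finite) auto
  ultimately show ?thesis using rsquarefree_card_roots[OF t] deg by blast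
qed

section \<open>Linear recurrences and their perturbation\<close>

fun recurrent_seq :: "(nat \<Rightarrow> complex) \<Rightarrow> complex poly \<Rightarrow> nat \<Rightarrow> nat \<Rightarrow> complex" where
  "recurrent_seq h f r i =
     (if i < r then h i else - (\<Sum>j<r. coeff f j * recurrent_seq h f r (i - r + j)))"

declare recurrent_seq.simps [simp del]

text \<open>Setting this to 0 is the recurrence of \<open>recurrent_seq\<close>, in which the
  coefficient of \<open>X ^ r\<close> is implicitly 1.\<close>

lemma seq_functional_monic_monom:
  assumes "degree f = r" "lead_coeff f = 1"
  shows "seq_functional h (f * monom 1 i) = (\<Sum>j<r. coeff f j * h (i + j)) + h (i + r)"
proof -
  have "f * monom 1 i = (\<Sum>j\<le>r. monom (coeff f j) j) * monom 1 i"
    using assms(1) by (subst poly_as_sum_of_monoms') auto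
  also have "\<dots> = (\<Sum>j\<le>r. monom (coeff f j) (i + j))"
    by (simp add: sum_distrib_right mult_monom add.commute)
  finally have "seq_functional h (f * monom 1 i) = (\<Sum>j\<le>r. coeff f j * h (i + j))"
    by (simp add: seq_functional_sum seq_functional_monom)
  also have "{..r} = insert r {..<r}" by auto
  finally show ?thesis using assms by simp
qed

lemma annihilates_recurrent_seq:
  assumes "degree f = r" "lead_coeff f = 1"
  shows "annihilates f (recurrent_seq h f r) r N"
proof (rule annihilatesI[of _ _ _ _ "monom 1 1"])
  fix i
  show "seq_functional (recurrent_seq h f r) (f * monom 1 1 ^ i) = 0"
    using recurrent_seq.simps[of h f r "i + r"]
    by (simp add: monom_power seq_functional_monic_monom[OF assms])
qed (simp add: degree_monom_eq)

lemma recurrent_seq_eqI: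
  assumes "degree f = r" "lead_coeff f = 1" and ann: "annihilates f h r N" and "i \<le> N"
  shows "recurrent_seq h f r i = h i"
  using \<open>i \<le> N\<close>
proof (induction i rule: less_induct)
  case (less i)
  show ?case
  proof (cases "i < r")
    case False
    have "seq_functional h (f * monom 1 (i - r)) = 0"
      using ann less.prems False unfolding annihilates_def by (simp add: degree_monom_eq)
    then have "h i = - (\<Sum>j<r. coeff f j * h (i - r + j))"
      using False by (simp add: seq_functional_monic_monom[OF assms(1,2)] add_eq_0_iff)
    also have "\<dots> = - (\<Sum>j<r. coeff f j * recurrent_seq h f r (i - r + j))"
      using less False by (intro arg_cong[of _ _ uminus] sum.cong) auto
    finally show ?thesis using False by (simp add: recurrent_seq.simps[of _ _ _ i])
  qed (simp add: recurrent_seq.simps)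
qed

text \<open>Each entry is a polynomial expression in the coefficients of the characteristic
  polynomial.\<close>

lemma tendsto_recurrent_seq:
  assumes "\<And>j. ((\<lambda>t. coeff (f t) j) \<longlongrightarrow> coeff f0 j) F"
  shows "((\<lambda>t. recurrent_seq h (f t) r i) \<longlongrightarrow> recurrent_seq h f0 r i) F"
proof (induction i rule: less_induct)
  case (less i)
  show ?case
    unfolding recurrent_seq.simps[of _ _ _ i] using less
    by (auto intro!: tendsto_intros assms)
qed

text \<open>\<open>f\<close> and the constant 1 have no common root, so \<open>f + t\<close> is
  squarefree for all but finitely many \<open>t\<close>. The solutions of these recurrences that
  start with the first \<open>r\<close> entries of \<open>h\<close> are carried by \<open>r\<close>
  nodes; as \<open>t\<close> tends to 0 they converge to the solution for \<open>f\<close>, which is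
  \<open>h\<close> up to \<open>N\<close>.\<close>

lemma squarefree_approximation:
  assumes f: "degree f = r" "lead_coeff f = 1" "r > 0" and ann: "annihilates f h r N"
  shows "\<exists>h'. (\<forall>t::nat. \<exists>S w. finite S \<and> card S = r \<and> (\<forall>i\<le>N. h' t i = (\<Sum>x\<in>S. w x * x ^ i))) \<and>
     (\<forall>i\<le>N. (\<lambda>t. h' t i) \<longlonglongrightarrow> h i)"
proof -
  have fin: "finite {t. \<not> rsquarefree (f + smult t 1)}"
    by (rule finite_not_rsquarefree_pencil) (use f in auto)
  have "\<exists>T::nat \<Rightarrow> complex. (\<forall>t. rsquarefree (f + [:T t:])) \<and> T \<longlonglongrightarrow> 0"
  proof -
    let ?B = "{t. \<not> rsquarefree (f + smult t 1)}" and ?u = "\<lambda>m::nat. 1 / of_nat (Suc m) :: complex"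
    have "inj ?u" by (intro injI) simp
    \<comment> \<open>Only finitely many of the numbers \<open>1 / (m + 1)\<close> are exceptional,
      and a shift of the index skips them.\<close>
    then have "finite {m. ?u m \<in> ?B}" using finite_vimageI[OF fin, of ?u] by (simp add: vimage_def)
    then obtain M where M: "\<And>m. m \<ge> M \<Longrightarrow> ?u m \<notin> ?B"
      by (metis (no_types, lifting) finite_nat_set_iff_bounded linorder_not_less mem_Collect_eq)
    have "?u \<longlonglongrightarrow> 0" by (rule LIMSEQ_Suc[OF lim_1_over_n])
    then have "(\<lambda>t. ?u (t + M)) \<longlonglongrightarrow> 0" by (rule LIMSEQ_ignore_initial_segment)
    moreover have "rsquarefree (f + [:?u (t + M):])" for t using M[of "t + M"] by simp
    ultimately show ?thesis by (intro exI[of _ "\<lambda>t. ?u (t + M)"] conjI allI)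
  qed
  then obtain T where T: "\<And>t::nat. rsquarefree (f + [:T t:])" "T \<longlonglongrightarrow> 0" by blast
  define f' where "f' t = f + [:T t:]" for t
  \<comment> \<open>As \<open>r > 0\<close>, changing the constant coefficient leaves the leading
    term intact.\<close>
  have deg: "degree (f' t) = r" for t
    unfolding f'_def using f by (subst degree_add_eq_left) auto
  have lc: "lead_coeff (f' t) = 1" for t
    using f deg[of t] by (simp add: f'_def coeff_pCons split: nat.split)
  define h' where "h' t = recurrent_seq h (f' t) r" for t
  have "\<exists>S w. finite S \<and> card S = r \<and> (\<forall>i\<le>N. h' t i = (\<Sum>x\<in>S. w x * x ^ i))" for t
  proof -
    have "annihilates (f' t) (h' t) (degree (f' t)) N"
      unfolding h'_def deg by (rule annihilates_recurrent_seq[OF deg lc])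
    then obtain w where w: "\<And>p. degree p \<le> N \<Longrightarrow>
        seq_functional (h' t) p = (\<Sum>x | poly (f' t) x = 0. w x * poly p x)"
      using annihilator_quadrature[of "f' t"] T(1) unfolding f'_def by blast
    have "h' t i = (\<Sum>x | poly (f' t) x = 0. w x * x ^ i)" if "i \<le> N" for i
      using w[of "monom 1 i"] that by (simp add: degree_monom_eq seq_functional_monom poly_monom)
    moreover have "finite {x. poly (f' t) x = 0}" 
      using deg[of t] f(3) by (intro poly_roots_finite) auto
    moreover have "card {x. poly (f' t) x = 0} = r"
      using rsquarefree_card_roots[of "f' t"] deg T(1) by (simp add: f'_def)
    ultimately show ?thesis by (intro exI[of _ "{x. poly (f' t) x = 0}"] exI[of _ w]) simp
  qed
  moreover have "(\<lambda>t. h' t i) \<longlonglongrightarrow> h i" if "i \<le> N" for i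
  proof -
    have "(\<lambda>t. coeff (f' t) j) \<longlonglongrightarrow> coeff f j" for j
      unfolding f'_def using T(2) by (cases j) (auto intro!: tendsto_eq_intros)
    then have "(\<lambda>t. h' t i) \<longlonglongrightarrow> recurrent_seq h f r i"
      unfolding h'_def by (rule tendsto_recurrent_seq)
    then show ?thesis using recurrent_seq_eqI[OF f(1,2) ann that] by simp
  qed
  ultimately show ?thesis by blast
qed

section \<open>Binary forms and coordinate changes\<close>

lemma binary_form_cong:
  "(\<And>j. j \<le> e \<Longrightarrow> c j = c' j) \<Longrightarrow> binary_form e c x y = binary_form e c' x y"
  unfolding binary_form_def by (intro sum.cong) auto

text \<open>For fixed \<open>x\<close> the three forms are polynomials in \<open>y\<close>, so it
  suffices to compare their coefficients.\<close>

lemma binary_form_mult: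
  assumes p: "degree p \<le> e" and q: "degree q \<le> e'"
  shows "binary_form (e + e') (coeff (p * q)) x y = binary_form e (coeff p) x y * binary_form e' (coeff q) x y"
proof -
  define P where "P = (\<Sum>j\<le>e. monom (coeff p j * x ^ (e - j)) j)"
  define Q where "Q = (\<Sum>j\<le>e'. monom (coeff q j * x ^ (e' - j)) j)"
  define R where "R = (\<Sum>j\<le>e + e'. monom (coeff (p * q) j * x ^ (e + e' - j)) j)"
  have cP: "coeff P j = coeff p j * x ^ (e - j)" for j
    using p by (auto simp: P_def coeff_sum coeff_eq_0)
  have cQ: "coeff Q j = coeff q j * x ^ (e' - j)" for j
    using q by (auto simp: Q_def coeff_sum coeff_eq_0)
  have cR: "coeff R j = coeff (p * q) j * x ^ (e + e' - j)" for j
    using order_trans[OF degree_mult_le add_mono[OF p q]] by (auto simp: R_def coeff_sum coeff_eq_0)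
  have "R = P * Q"
  proof (rule poly_eqI)
    fix n
    \<comment> \<open>The exponents of \<open>x\<close> add up unless a subtraction truncates, and
      then one of the two coefficients is 0.\<close>
    have "coeff p i * coeff q (n - i) * x ^ (e + e' - n) =
        coeff p i * x ^ (e - i) * (coeff q (n - i) * x ^ (e' - (n - i)))" if "i \<le> n" for i
    proof (cases "i \<le> e \<and> n - i \<le> e'")
      case True
      then have "e + e' - n = (e - i) + (e' - (n - i))" using that by linarith
      then show ?thesis by (simp add: power_add)
    qed (use p q in \<open>auto simp: coeff_eq_0\<close>)
    then show "coeff R n = coeff (P * Q) n"
      unfolding cR coeff_mult cP cQ sum_distrib_right by (intro sum.cong) auto
  qed
  then have "poly R y = poly P y * poly Q y" by simp
  then show ?thesis
    by (simp add: R_def P_def Q_def poly_sum poly_monom binary_form_def)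
qed

lemma binary_form_add: "binary_form e (\<lambda>j. c j + c' j) x y = binary_form e c x y + binary_form e c' x y"
  by (simp add: binary_form_def distrib_right sum.distrib)

lemma binary_form_scale: "binary_form e (\<lambda>j. a * c j) x y = a * binary_form e c x y"
  by (simp add: binary_form_def sum_distrib_left mult.assoc)

lemma binary_form_coeff_sum:
  "binary_form e (coeff (\<Sum>i\<in>I. smult (a i) (p i))) x y = (\<Sum>i\<in>I. a i * binary_form e (coeff (p i)) x y)"
proof (induction I rule: infinite_finite_induct)
  case (insert i I)
  have "coeff (\<Sum>i\<in>insert i I. smult (a i) (p i)) = (\<lambda>j. a i * coeff (p i) j + coeff (\<Sum>i\<in>I. smult (a i) (p i)) j)"
    using insert by auto
  then show ?case using insert by (simp add: binary_form_add binary_form_scale)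
qed (simp_all add: binary_form_def)

lemma binary_form_eq_poly:
  assumes "degree p \<le> e"
  shows "binary_form e (coeff p) 1 x = poly p x"
  unfolding binary_form_def poly_altdef
  by (rule sum.mono_neutral_cong_right) (use assms in \<open>auto simp: coeff_eq_0\<close>)

lemma binary_form_linear: "binary_form (Suc 0) (coeff [:a, b:]) x y = a * x + b * y"
  by (simp add: binary_form_def)

lemma binary_form_linear_power: 
  "binary_form e (coeff ([:a, b:] ^ e)) x y = (a * x + b * y) ^ e"
proof (induction e)
  case (Suc e)
  have "degree ([:a, b:] ^ e) \<le> e" using degree_power_le[of "[:a, b:]" e] by (simp split: if_splits)
  then have "binary_form (Suc 0 + e) (coeff ([:a, b:] * [:a, b:] ^ e)) x y = (a * x + b * y) * (a * x + b * y) ^ e"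
    using Suc by (subst binary_form_mult) (simp_all only: binary_form_linear, auto)
  then show ?case by (simp only: power_Suc plus_nat.simps)
qed (simp add: binary_form_def)

text \<open>With \<open>p\<close> read as a form \<open>F(x, y)\<close> of degree \<open>e\<close>, where \<open>coeff p j\<close> belongs to \<open>x ^ (e - j) * y ^ j\<close>,
  this is the form \<open>F(y - c x, x)\<close>: a root of \<open>p\<close> at infinity is moved to \<open>c\<close>.\<close>
definition shear_flip :: "complex \<Rightarrow> nat \<Rightarrow> complex poly \<Rightarrow> complex poly" where
  "shear_flip c e p = (\<Sum>j\<le>e. smult (coeff p j) ([:-c, 1:] ^ (e - j)))"

lemma poly_shear_flip: "poly (shear_flip c e p) z = binary_form e (coeff p) (z - c) 1"
  by (simp add: shear_flip_def binary_form_def poly_sum)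

lemma degree_shear_flip: "degree (shear_flip c e p) \<le> e"
proof -
  have "degree (smult (coeff p j) ([:-c, 1:] ^ (e - j))) \<le> e" for j
    using degree_power_le[of "[:-c, 1:]" "e - j"] by (intro order_trans[OF degree_smult_le]) simp
  then show ?thesis unfolding shear_flip_def by (intro degree_sum_le) auto
qed

lemma shear_flip_mult:
  assumes "degree p \<le> e" "degree q \<le> e'"
  shows "shear_flip c (e + e') (p * q) = shear_flip c e p * shear_flip c e' q"
proof -
  have "poly (shear_flip c (e + e') (p * q)) = poly (shear_flip c e p * shear_flip c e' q)"
    by (rule ext) (simp add: poly_shear_flip binary_form_mult[OF assms])
  then show ?thesis by (simp only: poly_eq_poly_eq_iff)
qed

lemma shear_flip_monom: "i \<le> e \<Longrightarrow> shear_flip c e (monom 1 i) = [:-c, 1:] ^ (e - i)"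
  by (simp add: shear_flip_def if_distrib[of "\<lambda>x. smult x _"] cong: if_cong)

text \<open>The preimage has the Taylor coefficients of \<open>f\<close> at \<open>c\<close> in
  reverse order. Its top coefficient is \<open>poly f c\<close>, so a \<open>c\<close> that is not a
  root of \<open>f\<close> gives exact degree \<open>r\<close>.\<close>

lemma shear_flip_surj:
  assumes "degree f \<le> r"
  shows "\<exists>g. degree g \<le> r \<and> coeff g r = poly f c \<and> shear_flip c r g = f"
proof -
  define \<phi> where "\<phi> = pcompose f [:c, 1:]"
  define g where "g = (\<Sum>j\<le>r. monom (coeff \<phi> (r - j)) j)"
  have deg_\<phi>: "degree \<phi> \<le> r" using assms by (simp add: \<phi>_def degree_pcompose)
  have cg: "coeff g j = (if j \<le> r then coeff \<phi> (r - j) else 0)" for j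
    by (simp add: g_def coeff_sum)
  have "poly (shear_flip c r g) z = poly f z" for z
  proof -
    have "poly (shear_flip c r g) z = (\<Sum>j\<le>r. coeff \<phi> (r - j) * (z - c) ^ (r - j))"
      by (simp add: poly_shear_flip binary_form_def cg)
    also have "\<dots> = (\<Sum>j\<le>r. coeff \<phi> j * (z - c) ^ j)"
      by (rule sum.reindex_bij_witness[of _ "\<lambda>j. r - j" "\<lambda>j. r - j"]) auto
    also have "\<dots> = binary_form r (coeff \<phi>) 1 (z - c)" by (simp add: binary_form_def)
    also have "\<dots> = poly f z" by (simp add: binary_form_eq_poly[OF deg_\<phi>]) (simp add: \<phi>_def poly_pcompose)
    finally show ?thesis .
  qed
  then have "shear_flip c r g = f" by (simp add: poly_eq_poly_eq_iff[symmetric] fun_eq_iff)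
  moreover have "degree g \<le> r" by (rule degree_le) (simp add: cg)
  moreover have "coeff g r = poly f c"
    by (simp add: cg \<phi>_def flip: poly_0_coeff_0) (simp add: poly_pcompose)
  ultimately show ?thesis by blast
qed

lemma shear_flip_eq_0:
  assumes "shear_flip c e p = 0" "degree p \<le> e"
  shows "p = 0"
proof -
  \<comment> \<open>Reversing the coefficients of \<open>p\<close> gives
    \<open>shear_flip c e p\<close> translated by \<open>c\<close>.\<close>
  define q where "q = (\<Sum>j\<le>e. monom (coeff p (e - j)) j)"
  have "poly q z = 0" for z
  proof -
    have "poly q z = (\<Sum>j\<le>e. coeff p (e - j) * z ^ j)"
      by (simp add: q_def poly_sum poly_monom)
    also have "\<dots> = (\<Sum>j\<le>e. coeff p j * z ^ (e - j))"
      by (rule sum.reindex_bij_witness[of _ "\<lambda>j. e - j" "\<lambda>j. e - j"]) auto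
    also have "\<dots> = poly (shear_flip c e p) (z + c)"
      by (simp add: poly_shear_flip binary_form_def)
    finally show ?thesis using assms(1) by simp
  qed
  then have "q = 0" using poly_all_0_iff_0[of q] by simp
  moreover have "coeff q j = coeff p (e - j)" if "j \<le> e" for j
    using that by (simp add: q_def coeff_sum)
  ultimately have "coeff p (e - j) = 0" if "j \<le> e" for j
    using that by (metis coeff_0)
  then have coeff_0: "coeff p j = 0" if "j \<le> e" for j
    using that by (metis diff_diff_cancel diff_le_self)
  have "coeff p j = 0" for j
    using coeff_0[of j] assms(2) coeff_eq_0[of p j] by (cases "j \<le> e") auto
  then show ?thesis by (simp add: poly_eq_iff)
qed

lemma binary_form_shear_flip:
  "binary_form e (coeff (shear_flip c e p)) x y = binary_form e (coeff p) (y - c * x) x"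
proof -
  have "binary_form e (coeff ([:-c, 1:] ^ (e - j))) x y = (y - c * x) ^ (e - j) * x ^ j" if "j \<le> e" for j
  proof -
    have "degree ([:-c, 1:] ^ (e - j)) \<le> e - j" using degree_power_le[of "[:-c, 1:]" "e - j"] by simp
    \<comment> \<open>The factor 1, read as a form of degree \<open>j\<close>, is
      \<open>x ^ j\<close>; it pads the power to degree \<open>e\<close>.\<close>
    then have "binary_form ((e - j) + j) (coeff ([:-c, 1:] ^ (e - j) * 1)) x y =
        binary_form (e - j) (coeff ([:-c, 1:] ^ (e - j))) x y * binary_form j (coeff 1) x y"
      by (rule binary_form_mult) simp
    moreover have "binary_form j (coeff 1) x y = x ^ j"
      by (simp add: binary_form_def of_bool_def if_distrib[of "\<lambda>u. u * _"] cong: if_cong)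
    ultimately show ?thesis using that by (simp add: binary_form_linear_power)
  qed
  then show ?thesis
    by (simp add: shear_flip_def binary_form_coeff_sum) (simp add: binary_form_def mult.assoc)
qed

lemma not_rsquarefree_double_root:
  fixes p :: "complex poly"
  assumes "\<not> rsquarefree p"
  shows "\<exists>\<xi> q. p = [:-\<xi>, 1:] ^ 2 * q"
proof -
  obtain \<xi> where \<xi>: "poly p \<xi> = 0" "poly (pderiv p) \<xi> = 0"
    using assms by (auto simp: rsquarefree_roots)
  obtain u where u: "p = [:-\<xi>, 1:] * u" using \<xi>(1) by (metis dvdE poly_eq_0_iff_dvd)
  have "poly u \<xi> = 0" using \<xi>(2) unfolding u by (simp del: mult_pCons_left add: pderiv_mult pderiv_pCons)
  then obtain q where "u = [:-\<xi>, 1:] * q" by (metis dvdE poly_eq_0_iff_dvd)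
  then show ?thesis using u by (intro exI[of _ \<xi>] exI[of _ q]) (simp only: power2_eq_square mult.assoc)
qed

text \<open>The coordinate change carries a double root of \<open>g\<close> to a squared linear
  factor, and \<open>degree g = r\<close> bounds the degree of the cofactor by
  \<open>r - 2\<close>.\<close>

lemma rsquarefree_shear_flip:
  assumes deg: "degree g = r" and "g \<noteq> 0" and nmr: "\<not> has_multiple_root r (coeff (shear_flip c r g))"
  shows "rsquarefree g"
proof (rule ccontr)
  assume "\<not> rsquarefree g"
  then obtain \<xi> q where q: "g = [:-\<xi>, 1:] ^ 2 * q" using not_rsquarefree_double_root by blast
  have "q \<noteq> 0" using \<open>g \<noteq> 0\<close> q by auto
  then have "degree g = 2 + degree q" by (simp add: q degree_mult_eq degree_power_eq)
  then have r: "r = 2 + (r - 2)" "degree q \<le> r - 2" using deg by auto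
  have "degree ([:-\<xi>, 1:] ^ 2) \<le> 2" by (simp add: degree_power_eq)
  \<comment> \<open>The factor \<open>y - \<xi> x\<close> becomes \<open>x - \<xi> (y - c x)\<close>
    when \<open>(y - c x, x)\<close> is substituted for \<open>(x, y)\<close>.\<close>
  then have "binary_form r (coeff (shear_flip c r g)) x y =
      ((1 + \<xi> * c) * x - \<xi> * y)\<^sup>2 * binary_form (r - 2) (coeff (shear_flip c (r - 2) q)) x y" for x y
    unfolding binary_form_shear_flip q 
    by (subst r(1), subst binary_form_mult) (use r in \<open>simp_all add: binary_form_linear_power algebra_simps\<close>)
  moreover have "(\<xi>, 1 + \<xi> * c) \<noteq> (0, 0)" by auto
  ultimately have "has_multiple_root r (coeff (shear_flip c r g))"
    unfolding has_multiple_root_def by blast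
  then show False using nmr by contradiction
qed

text \<open>Equivalently, the binary form with coefficients \<open>(d choose i) * h i\<close> is a
  sum of \<open>R\<close> powers \<open>(a k * x + b k * y) ^ d\<close>. Terms with
  \<open>a k = 0\<close> are nodes at infinity, and zero terms are allowed.\<close>

definition sum_of_powers :: "nat \<Rightarrow> nat \<Rightarrow> (nat \<Rightarrow> complex) \<Rightarrow> bool" where
  "sum_of_powers d R h \<longleftrightarrow> (\<exists>a b :: nat \<Rightarrow> complex. \<forall>i\<le>d. h i = (\<Sum>k<R. a k ^ (d - i) * b k ^ i))"

text \<open>A complex weight \<open>w x\<close> is a power \<open>a ^ d\<close> and can be absorbed
  into the node, giving the pair \<open>(a, a * x)\<close>.\<close>

lemma sum_of_powersI:
  assumes S: "finite S" "card S = R" and h: "\<And>i. i \<le> d \<Longrightarrow> h i = (\<Sum>x\<in>S. w x * x ^ i)" and d: "d > 0"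
  shows "sum_of_powers d R h"
proof -
  obtain e where e: "bij_betw e {..<R} S"
    using S ex_bij_betw_nat_finite[OF S(1)] by (auto simp: lessThan_atLeast0)
  have "\<forall>x. \<exists>a. a ^ d = w x" using nth_root_exists[OF d] by blast
  then obtain a where a: "\<And>x. a x ^ d = w x" by metis
  have "h i = (\<Sum>k<R. a (e k) ^ (d - i) * (a (e k) * e k) ^ i)" if "i \<le> d" for i
  proof -
    have "a x ^ (d - i) * (a x * x) ^ i = w x * x ^ i" for x
      using that by (simp add: a[symmetric] power_mult_distrib flip: power_add mult.assoc)
    then show ?thesis using that sum.reindex_bij_betw[OF e, of "\<lambda>x. w x * x ^ i"] by (simp add: h)
  qed
  then show ?thesis unfolding sum_of_powers_def
    by (intro exI[of _ "\<lambda>k. a (e k)"] exI[of _ "\<lambda>k. a (e k) * e k"] allI impI)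
qed

text \<open>The pullback of the functional \<open>h\<close> along \<open>shear_flip c d\<close>,
  which maps \<open>X ^ i\<close> to \<open>(X - c) ^ (d - i)\<close>.\<close>

definition shear_flip_seq :: "complex \<Rightarrow> nat \<Rightarrow> (nat \<Rightarrow> complex) \<Rightarrow> nat \<Rightarrow> complex" where
  "shear_flip_seq c d h i = seq_functional h ([:-c, 1:] ^ (d - i))"

text \<open>Recovers the original entries from the binomial expansion of
  \<open>X ^ i = ((X - c) + c) ^ i\<close>.\<close>

definition unshear_flip_seq :: "complex \<Rightarrow> nat \<Rightarrow> (nat \<Rightarrow> complex) \<Rightarrow> nat \<Rightarrow> complex" where
  "unshear_flip_seq c d h i = (\<Sum>j\<le>i. of_nat (i choose j) * c ^ (i - j) * h (d - j))"

lemma unshear_flip_shear_flip: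
  assumes "i \<le> d"
  shows "unshear_flip_seq c d (shear_flip_seq c d h) i = h i"
proof -
  have "monom 1 i = ([:-c, 1:] + [:c:]) ^ i" by (simp add: monom_altdef)
  also have "\<dots> = (\<Sum>j\<le>i. smult (of_nat (i choose j) * c ^ (i - j)) ([:-c, 1:] ^ j))"
    unfolding binomial_ring by (intro sum.cong) (simp_all add: poly_const_pow of_nat_poly mult.commute)
  finally have "seq_functional h (monom 1 i) =
      (\<Sum>j\<le>i. of_nat (i choose j) * c ^ (i - j) * seq_functional h ([:-c, 1:] ^ j))"
    by (simp only: seq_functional_sum seq_functional_smult)
  then show ?thesis
    using assms by (simp add: seq_functional_monom unshear_flip_seq_def shear_flip_seq_def)
qed

text \<open>The coordinate change acts linearly on nodes: by the binomial theorem
  \<open>(a, b)\<close> becomes \<open>(b, a + c * b)\<close>.\<close>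

lemma sum_of_powers_unshear_flip:
  assumes "sum_of_powers d R h"
  shows "sum_of_powers d R (unshear_flip_seq c d h)"
proof -
  obtain a b where ab: "\<And>i. i \<le> d \<Longrightarrow> h i = (\<Sum>k<R. a k ^ (d - i) * b k ^ i)"
    using assms unfolding sum_of_powers_def by blast
  have "unshear_flip_seq c d h i = (\<Sum>k<R. b k ^ (d - i) * (a k + c * b k) ^ i)" if i: "i \<le> d" for i
  proof -
    have "unshear_flip_seq c d h i =
        (\<Sum>j\<le>i. \<Sum>k<R. of_nat (i choose j) * c ^ (i - j) * (a k ^ j * b k ^ (d - j)))"
      unfolding unshear_flip_seq_def using i by (intro sum.cong) (auto simp: ab sum_distrib_left)
    also have "\<dots> = (\<Sum>k<R. \<Sum>j\<le>i. of_nat (i choose j) * c ^ (i - j) * (a k ^ j * b k ^ (d - j)))"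
      by (rule sum.swap)
    also have "\<dots> = (\<Sum>k<R. \<Sum>j\<le>i. b k ^ (d - i) * (of_nat (i choose j) * a k ^ j * (c * b k) ^ (i - j)))"
    proof (intro sum.cong refl)
      fix k j assume "j \<in> {..i}"
      then have "d - j = (d - i) + (i - j)" using i by simp
      then show "of_nat (i choose j) * c ^ (i - j) * (a k ^ j * b k ^ (d - j)) =
          b k ^ (d - i) * (of_nat (i choose j) * a k ^ j * (c * b k) ^ (i - j))"
        by (simp add: power_add power_mult_distrib)
    qed
    finally show ?thesis by (simp add: binomial_ring sum_distrib_left)
  qed
  then show ?thesis
    unfolding sum_of_powers_def by (intro exI[of _ b] exI[of _ "\<lambda>k. a k + c * b k"] allI impI)
qed

lemma sum_of_powers_cong:
  "(\<And>i. i \<le> d \<Longrightarrow> h i = h' i) \<Longrightarrow> sum_of_powers d R h \<longleftrightarrow> sum_of_powers d R h'"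
  unfolding sum_of_powers_def by simp

lemma sum_of_powers_shear_flipD:
  assumes "sum_of_powers d R (shear_flip_seq c d h)"
  shows "sum_of_powers d R h"
  using sum_of_powers_unshear_flip[OF assms, of c] unshear_flip_shear_flip
    sum_of_powers_cong[of d "unshear_flip_seq c d (shear_flip_seq c d h)" h] by simp

lemma seq_functional_shear_flip:
  assumes "degree p \<le> d"
  shows "seq_functional (shear_flip_seq c d h) p = seq_functional h (shear_flip c d p)"
  unfolding shear_flip_def seq_functional_sum seq_functional_smult
  by (simp add: seq_functional_altdef[OF assms] shear_flip_seq_def)

text \<open>No nonzero form of degree \<open>r - 1\<close> annihilates \<open>h\<close>. The
  condition \<open>degree q + (r - 1) \<le> d\<close> is shifted by 1 on both sides to avoid
  truncated subtraction at \<open>r = 0\<close>, where the property is vacuous.\<close>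

definition apolar_free_below :: "nat \<Rightarrow> nat \<Rightarrow> (nat \<Rightarrow> complex) \<Rightarrow> bool" where
  "apolar_free_below r d h \<longleftrightarrow> (\<forall>g. degree g < r \<longrightarrow> annihilates g h r (d + 1) \<longrightarrow> g = 0)"

lemma annihilates_shear_flip:
  assumes f: "degree f \<le> r" and ann: "annihilates (shear_flip c r f) h r d"
  shows "annihilates f (shear_flip_seq c d h) r d"
  unfolding annihilates_def
proof (intro allI impI)
  fix q :: "complex poly" assume q: "degree q + r \<le> d"
  then have d: "d = r + (d - r)" and q': "degree q \<le> d - r" by auto
  have "degree (f * q) \<le> d" using degree_mult_le[of f q] f q by linarith
  then have "seq_functional (shear_flip_seq c d h) (f * q) = seq_functional h (shear_flip c (r + (d - r)) (f * q))"
    using d by (simp add: seq_functional_shear_flip)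
  also have "\<dots> = seq_functional h (shear_flip c r f * shear_flip c (d - r) q)"
    by (simp only: shear_flip_mult[OF f q'])
  also have "\<dots> = 0" using ann degree_shear_flip[of c "d - r" q] d unfolding annihilates_def by simp
  finally show "seq_functional (shear_flip_seq c d h) (f * q) = 0" .
qed

text \<open>An annihilator of the transformed sequence is mapped by the injective
  \<open>shear_flip c (r - 1)\<close> to one of \<open>h\<close>. Powers of \<open>X - c\<close>
  serve as test polynomials because they are images of monomials.\<close>

lemma apolar_free_below_shear_flip:
  assumes "apolar_free_below r d h" and "r \<le> d"
  shows "apolar_free_below r d (shear_flip_seq c d h)"
  unfolding apolar_free_below_def
proof (intro allI impI)
  fix g assume g: "degree g < r" and ann: "annihilates g (shear_flip_seq c d h) r (d + 1)"
  have "annihilates (shear_flip c (r - 1) g) h r (d + 1)"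
  proof (rule annihilatesI[of _ _ _ _ "[:-c, 1:]"])
    fix i assume i: "i + r \<le> d + 1"
    \<comment> \<open>The monomial that \<open>shear_flip c (d + 1 - r)\<close> maps to
      \<open>(X - c) ^ i\<close>.\<close>
    let ?m = "monom 1 (d + 1 - r - i) :: complex poly"
    have d: "d = (r - 1) + (d + 1 - r)" using g i by linarith
    have "shear_flip c (r - 1) g * [:-c, 1:] ^ i = shear_flip c (r - 1) g * shear_flip c (d + 1 - r) ?m"
      using i by (simp add: shear_flip_monom)
    also have "\<dots> = shear_flip c ((r - 1) + (d + 1 - r)) (g * ?m)"
      using g by (intro shear_flip_mult[symmetric]) (auto simp: degree_monom_eq)
    also have "\<dots> = shear_flip c d (g * ?m)" using d by simp
    finally have "seq_functional h (shear_flip c (r - 1) g * [:-c, 1:] ^ i) = 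
        seq_functional h (shear_flip c d (g * ?m))" by simp
    also have "degree (g * ?m) \<le> d"
      using degree_mult_le[of g ?m] g i by (simp add: degree_monom_eq)
    then have "seq_functional h (shear_flip c d (g * ?m)) = seq_functional (shear_flip_seq c d h) (g * ?m)"
      by (simp add: seq_functional_shear_flip)
    also have "\<dots> = 0" using ann i unfolding annihilates_def by (simp add: degree_monom_eq)
    finally show "seq_functional h (shear_flip c (r - 1) g * [:-c, 1:] ^ i) = 0" .
  qed simp
  moreover have "degree (shear_flip c (r - 1) g) < r"
    using degree_shear_flip[of c "r - 1" g] g by linarith
  ultimately have "shear_flip c (r - 1) g = 0"
    using assms(1) unfolding apolar_free_below_def by blast
  then show "g = 0" by (rule shear_flip_eq_0) (use g in simp)
qed

text \<open>Choosing \<open>c\<close> outside the roots of \<open>f\<close> moves all roots away from infinity.\<close>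
lemma monic_annihilator:
  assumes f: "f \<noteq> 0" "degree f \<le> r" "annihilates f h r d"
    and free: "apolar_free_below r d h" and "r \<le> d"
  shows "\<exists>c g. degree g = r \<and> lead_coeff g = 1 \<and> annihilates g (shear_flip_seq c d h) r d \<and>
    apolar_free_below r d (shear_flip_seq c d h) \<and>
    (\<not> has_multiple_root r (coeff f) \<longrightarrow> rsquarefree g)"
proof -
  obtain c where c: "poly f c \<noteq> 0" using f(1) poly_all_0_iff_0 by blast
  obtain g where g: "degree g \<le> r" "coeff g r = poly f c" "shear_flip c r g = f"
    using shear_flip_surj[OF f(2)] by blast
  have deg: "degree g = r" using g c by (metis le_antisym le_degree)
  have ann: "annihilates g (shear_flip_seq c d h) r d"
    using f(3) g by (intro annihilates_shear_flip) auto
  have g0: "g \<noteq> 0" using g c by auto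
  have sf: "rsquarefree g" if "\<not> has_multiple_root r (coeff f)"
    using that rsquarefree_shear_flip[OF deg g0, of c, unfolded g(3)] by blast
  define a where "a = inverse (lead_coeff g)"
  have a: "a \<noteq> 0" using g0 by (simp add: a_def)
  show ?thesis
  proof (intro exI[of _ c] exI[of _ "smult a g"] conjI impI)
    show "degree (smult a g) = r" using deg a by simp
    show "lead_coeff (smult a g) = 1" using g0 by (simp add: a_def)
    show "annihilates (smult a g) (shear_flip_seq c d h) r d"
      using ann unfolding annihilates_def by (simp add: seq_functional_smult)
    show "apolar_free_below r d (shear_flip_seq c d h)"
      by (rule apolar_free_below_shear_flip[OF free assms(5)])
    show "rsquarefree (smult a g)" if "\<not> has_multiple_root r (coeff f)"
      using sf[OF that] a by (simp add: rsquarefree_roots pderiv_smult)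
  qed
qed

text \<open>Let \<open>v\<close> lie in the radical and divide a test polynomial by
  \<open>g\<close>. The multiple of \<open>g\<close> is killed by \<open>g\<close> and the remainder
  by \<open>v\<close>, so \<open>v\<close> is an annihilator of degree at most \<open>r - 1\<close>,
  hence 0.\<close>

lemma hankel_nonsingular_if_apolar_free:
  assumes g: "degree g = r" "lead_coeff g = 1" "annihilates g h r d" and free: "apolar_free_below r d h"
  shows "hankel_nonsingular r h"
  unfolding hankel_nonsingular_def
proof (intro allI impI)
  fix v assume v: "degree v < r" "\<forall>q. degree q < r \<longrightarrow> seq_functional h (v * q) = 0"
  have "annihilates v h r (d + 1)"
    unfolding annihilates_def
  proof (intro allI impI)
    fix q :: "complex poly" assume q: "degree q + r \<le> d + 1"
    have g0: "g \<noteq> 0" using g by auto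
    have "degree (q mod g) < r" using degree_mod_less[of g q] g0 g v(1) by auto
    then have 1: "seq_functional h (v * (q mod g)) = 0" using v(2) by blast
    have 2: "seq_functional h (g * (v * (q div g))) = 0"
    proof (cases "q div g = 0")
      case False
      then have "degree q = degree g + degree (q div g)"
        by (rule degree_eq_degree_add_degree_div[OF g0])
      then have "degree (v * (q div g)) + r \<le> d"
        using degree_mult_le[of v "q div g"] v(1) q g(1) by linarith
      then show ?thesis using g(3) unfolding annihilates_def by blast
    qed auto
    have "v * q = g * (v * (q div g)) + v * (q mod g)"
      using div_mult_mod_eq[of q g] by (metis (no_types, opaque_lifting) distrib_left mult.assoc mult.commute)
    then show "seq_functional h (v * q) = 0" using 1 2 by (simp add: seq_functional_add)
  qed
  then show "v = 0" using free v(1) unfolding apolar_free_below_def by blast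
qed

section \<open>Vandermonde decompositions of extremal length\<close>

text \<open>An element \<open>v\<close> of the large radical is first shown to be a multiple
  \<open>q g\<close>. Pairing it with a suitable \<open>g X ^ j\<close> then isolates the broken
  recurrence with the leading coefficient of \<open>q\<close> as factor.\<close>

lemma hankel_nonsingular_extension:
  assumes g: "degree g = r" "lead_coeff g = 1" "annihilates g h r d" and ns: "hankel_nonsingular r h"
    and rd: "2 * r \<le> d" and agree: "\<And>i. i \<le> d \<Longrightarrow> h' i = h i"
    and break: "seq_functional h' (g * monom 1 (d + 1 - r)) \<noteq> 0"
  shows "hankel_nonsingular (d - r + 2) h'"
  unfolding hankel_nonsingular_def
proof (intro allI impI)
  fix v assume v: "degree v < d - r + 2" "\<forall>q. degree q < d - r + 2 \<longrightarrow> seq_functional h' (v * q) = 0"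
  have eq: "seq_functional h' p = seq_functional h p" if "degree p \<le> d" for p
    using that agree by (rule seq_functional_cong)
  have ann: "seq_functional h' (g * q) = 0" if "degree q + r \<le> d" for q
    using g(3) that degree_mult_le[of g q] g(1) unfolding annihilates_def by (subst eq) auto
  have g0: "g \<noteq> 0" using g(2) by auto
  define q where "q = v div g"
  have vq: "v = q * g + v mod g" by (simp add: q_def)
  have deg_q: "q \<noteq> 0 \<Longrightarrow> degree v = r + degree q"
    unfolding q_def using degree_eq_degree_add_degree_div[OF g0, of v] g(1) by simp
  \<comment> \<open>When \<open>v\<close> is paired with polynomials of degree below
    \<open>r\<close>, the multiple of \<open>g\<close> drops out; so the remainder lies in the
    radical of the nonsingular small form.\<close>
  have "v mod g = 0"
  proof (cases "r = 0")
    case True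
    then show ?thesis using g0 g(1) by (metis degree_mod_less less_nat_zero_code)
  next
    case False
    have deg_m: "degree (v mod g) < r" using degree_mod_less[of g v] g0 g(1) False by auto
    have "seq_functional h (v mod g * p) = 0" if p: "degree p < r" for p
    proof -
      have "seq_functional h' (g * (q * p)) = 0"
      proof (cases "q = 0")
        case False
        then show ?thesis using deg_q v(1) p rd degree_mult_le[of q p] by (intro ann) linarith
      qed simp
      moreover have "v * p = g * (q * p) + v mod g * p"
        by (subst vq) (simp add: algebra_simps)
      moreover have "seq_functional h' (v * p) = 0" using v(2) p rd by simp
      ultimately have "seq_functional h' (v mod g * p) = 0" by (simp add: seq_functional_add)
      moreover have "degree (v mod g * p) \<le> d" 
        using degree_mult_le[of "v mod g" p] p deg_m rd by linarith
      ultimately show ?thesis using eq by simp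
    qed
    then show ?thesis using ns deg_m unfolding hankel_nonsingular_def by blast
  qed
  then have v_eq: "v = q * g" using vq by simp
  show "v = 0"
  proof (rule ccontr)
    assume "v \<noteq> 0"
    then have q0: "q \<noteq> 0" using v_eq by auto
    have dq: "degree q \<le> d + 1 - 2 * r" using deg_q[OF q0] v(1) by linarith
    \<comment> \<open>Makes the degree of \<open>p\<close> exactly \<open>d + 1 - r\<close>, while
      \<open>g X ^ j\<close> still has degree below \<open>d - r + 2\<close>.\<close>
    define j where "j = d + 1 - 2 * r - degree q"
    define p where "p = q * (g * monom 1 j)"
    have dm: "degree (g * monom 1 j) = r + j"
      using g0 g(1) by (subst degree_mult_eq) (auto simp: degree_monom_eq)
    then have dp: "degree p = d + 1 - r"
      unfolding p_def using g0 q0 dq rd by (subst degree_mult_eq) (auto simp: j_def)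
    have lp: "lead_coeff p = lead_coeff q"
      unfolding p_def lead_coeff_mult using g(2) by (simp add: degree_monom_eq)
    define p' where "p' = p - monom (lead_coeff p) (d + 1 - r)"
    have deg_p': "degree p' + r \<le> d"
    proof (cases "p' = 0")
      case False
      have "degree p' \<le> d + 1 - r" unfolding p'_def
        by (rule degree_diff_le) (use dp in \<open>auto intro: degree_monom_le\<close>)
      moreover have "coeff p' (d + 1 - r) = 0" by (simp add: p'_def dp)
      ultimately have "degree p' < d + 1 - r" using False
        by (metis leading_coeff_0_iff le_neq_implies_less)
      then show ?thesis using rd by linarith
    qed (use rd in simp)
    \<comment> \<open>Only the leading term of \<open>p\<close> meets the broken recurrence;
      \<open>g\<close> annihilates the rest.\<close>
    have "g * p = g * p' + smult (lead_coeff p) (g * monom 1 (d + 1 - r))"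
      by (simp add: p'_def algebra_simps smult_monom flip: mult_smult_right)
    then have "seq_functional h' (g * p) = lead_coeff q * seq_functional h' (g * monom 1 (d + 1 - r))"
      using ann[OF deg_p'] lp by (simp add: seq_functional_add seq_functional_smult)
    then have "seq_functional h' (g * p) \<noteq> 0" using break q0 by simp
    moreover have "seq_functional h' (v * (g * monom 1 j)) = 0"
      using v(2) dm rd dq by (auto simp: j_def)
    moreover have "g * p = v * (g * monom 1 j)" by (simp add: p_def v_eq algebra_simps)
    ultimately show False by simp
  qed
qed

lemma sum_of_powers_complement:
  assumes g: "degree g = r" "lead_coeff g = 1" "annihilates g h r d" and free: "apolar_free_below r d h"
    and rd: "2 * r \<le> d" and "d > 0"
  shows "sum_of_powers d (d - r + 2) h"
proof -
  \<comment> \<open>The value for entry \<open>d + 1\<close> at which the functional takes the value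
    1 on \<open>g X ^ (d + 1 - r)\<close>.\<close>
  define u where "u = 1 - (\<Sum>j<r. coeff g j * h (d + 1 - r + j))"
  define h' where "h' i = (if i \<le> d then h i else u)" for i
  have "hankel_nonsingular (d - r + 2) h'"
  proof (rule hankel_nonsingular_extension[OF g hankel_nonsingular_if_apolar_free[OF g free] rd])
    show "h' i = h i" if "i \<le> d" for i using that by (simp add: h'_def)
    have "(\<Sum>j<r. coeff g j * h' (d + 1 - r + j)) = (\<Sum>j<r. coeff g j * h (d + 1 - r + j))"
      by (intro sum.cong) (use rd in \<open>auto simp: h'_def\<close>)
    moreover have "h' (d + 1 - r + r) = u" using rd by (simp add: h'_def)
    ultimately show "seq_functional h' (g * monom 1 (d + 1 - r)) \<noteq> 0"
      unfolding seq_functional_monic_monom[OF g(1,2)] by (simp add: u_def)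
  qed
  then obtain S w where S: "finite S" "card S = d - r + 2"
      "\<And>i. i \<le> 2 * (d - r + 2) - 2 \<Longrightarrow> h' i = (\<Sum>x\<in>S. w x * x ^ i)"
    using hankel_nonsingular_nodes[of "d - r + 2" h'] by auto
  \<comment> \<open>\<open>2 * r \<le> d\<close> gives
    \<open>d \<le> 2 * (d - r + 2) - 2\<close>.\<close>
  have "h i = (\<Sum>x\<in>S. w x * x ^ i)" if "i \<le> d" for i
    using S(3)[of i] that rd by (simp add: h'_def)
  then show ?thesis using S(1,2) \<open>d > 0\<close> by (intro sum_of_powersI) auto
qed

text \<open>The term \<open>v\<close> is the weight of the point at infinity.\<close>
lemma sum_of_powers_nodes:
  assumes "sum_of_powers d R h" "d > 0"
  shows "\<exists>S w v. finite S \<and> card S + (if v = 0 then 0 else 1) \<le> R \<and>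
    (\<forall>p. degree p \<le> d \<longrightarrow> seq_functional h p = (\<Sum>x\<in>S. w x * poly p x) + v * coeff p d)"
proof -
  obtain a b where ab: "\<And>i. i \<le> d \<Longrightarrow> h i = (\<Sum>k<R. a k ^ (d - i) * b k ^ i)"
    using assms unfolding sum_of_powers_def by blast
  define I where "I = {k\<in>{..<R}. a k \<noteq> 0}"
  define J where "J = {k\<in>{..<R}. a k = 0}"
  define S where "S = (\<lambda>k. b k / a k) ` I"
  \<comment> \<open>Terms with the same ratio are merged into one node, whose weight may be
    0.\<close>
  define w where "w x = (\<Sum>k\<in>{k\<in>I. b k / a k = x}. a k ^ d)" for x
  define v where "v = (\<Sum>k\<in>J. b k ^ d)"
  have fin: "finite I" "finite J" by (auto simp: I_def J_def)
  have IJ: "I \<inter> J = {}" "I \<union> J = {..<R}" by (auto simp: I_def J_def)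
  have "card I + card J = R" using card_Un_disjoint[OF fin IJ(1)] IJ(2) by simp
  moreover have "card J \<ge> 1" if "v \<noteq> 0"
  proof -
    have "J \<noteq> {}" using that by (auto simp: v_def)
    then show ?thesis using fin(2) by (simp add: Suc_leI card_gt_0_iff)
  qed
  moreover have "card S \<le> card I" unfolding S_def by (rule card_image_le[OF fin(1)])
  ultimately have card: "card S + (if v = 0 then 0 else 1) \<le> R" by auto
  have h: "h i = (\<Sum>x\<in>S. w x * x ^ i) + v * (if i = d then 1 else 0)" if i: "i \<le> d" for i
  proof -
    have "h i = (\<Sum>k\<in>I. a k ^ (d - i) * b k ^ i) + (\<Sum>k\<in>J. a k ^ (d - i) * b k ^ i)"
      using ab[OF i] sum.union_disjoint[OF fin IJ(1)] IJ(2) by simp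
    \<comment> \<open>For \<open>a k = 0\<close> the power \<open>a k ^ (d - i)\<close> is 1 at
      \<open>i = d\<close> and 0 below.\<close>
    also have "(\<Sum>k\<in>J. a k ^ (d - i) * b k ^ i) = v * (if i = d then 1 else 0)"
      unfolding v_def sum_distrib_right using i by (intro sum.cong) (auto simp: J_def power_0_left)
    also have "(\<Sum>k\<in>I. a k ^ (d - i) * b k ^ i) = (\<Sum>k\<in>I. a k ^ d * (b k / a k) ^ i)"
    proof (rule sum.cong[OF refl])
      fix k assume "k \<in> I"
      then have "a k \<noteq> 0" by (simp add: I_def)
      then show "a k ^ (d - i) * b k ^ i = a k ^ d * (b k / a k) ^ i"
        using i by (simp add: power_diff power_divide)
    qed
    also have "\<dots> = (\<Sum>x\<in>S. \<Sum>k\<in>{k\<in>I. b k / a k = x}. a k ^ d * (b k / a k) ^ i)"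
      unfolding S_def by (rule sum.image_gen[OF fin(1)])
    also have "\<dots> = (\<Sum>x\<in>S. w x * x ^ i)"
      unfolding w_def sum_distrib_right by (intro sum.cong) auto
    finally show ?thesis .
  qed
  have "seq_functional h p = (\<Sum>x\<in>S. w x * poly p x) + v * coeff p d" if p: "degree p \<le> d" for p
  proof -
    have "seq_functional h p = (\<Sum>i\<le>d. (\<Sum>x\<in>S. coeff p i * (w x * x ^ i)) + coeff p i * (v * (if i = d then 1 else 0)))"
      unfolding seq_functional_altdef[OF p] by (intro sum.cong) (auto simp: h distrib_left sum_distrib_left)
    also have "\<dots> = (\<Sum>i\<le>d. \<Sum>x\<in>S. coeff p i * (w x * x ^ i)) + v * coeff p d"
      unfolding sum.distrib by (simp add: if_distrib[of "\<lambda>x. _ * x"] cong: if_cong)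
    also have "(\<Sum>i\<le>d. \<Sum>x\<in>S. coeff p i * (w x * x ^ i)) = (\<Sum>x\<in>S. \<Sum>i\<le>d. coeff p i * (w x * x ^ i))"
      by (rule sum.swap)
    also have "\<dots> = (\<Sum>x\<in>S. w x * poly p x)"
    proof (intro sum.cong refl)
      fix x
      have "poly p x = (\<Sum>i\<le>d. coeff p i * x ^ i)"
        using binary_form_eq_poly[OF p, of x] by (simp add: binary_form_def)
      then show "(\<Sum>i\<le>d. coeff p i * (w x * x ^ i)) = w x * poly p x"
        by (simp add: sum_distrib_left mult.left_commute)
    qed
    finally show ?thesis .
  qed
  moreover have "finite S" unfolding S_def using fin by simp
  ultimately show ?thesis using card by blast
qed

text \<open>For \<open>r < 2\<close> the cofactor degree \<open>r - 2\<close> truncates to 0, so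
  this case has to be excluded. Doubling both variables multiplies the form by \<open>2 ^ r\<close>
  but the factored expression by 4.\<close>

lemma has_multiple_root_imp_degree_ge_2:
  assumes "has_multiple_root r (coeff f)" "degree f \<le> r" "f \<noteq> 0"
  shows "r \<ge> 2"
proof (rule ccontr)
  assume "\<not> r \<ge> 2"
  then consider "r = 0" | "r = 1" by linarith
  then have scale: "binary_form r (coeff f) (2 * x) (2 * y) = 2 ^ r * binary_form r (coeff f) x y" for x y
    by cases (auto simp: binary_form_def algebra_simps)
  obtain \<alpha> \<beta> g where g: "\<And>x y. binary_form r (coeff f) x y = (\<beta> * x - \<alpha> * y)\<^sup>2 * binary_form (r - 2) g x y"
    using assms(1) unfolding has_multiple_root_def by blast
  have "binary_form r (coeff f) (2 * x) (2 * y) = 4 * binary_form r (coeff f) x y" for x y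
    unfolding g using \<open>\<not> r \<ge> 2\<close> by (simp add: binary_form_def power2_eq_square algebra_simps)
  then have "(4 - 2 ^ r) * binary_form r (coeff f) x y = 0" for x y
    using scale[of x y] by (simp add: left_diff_distrib)
  moreover have "(4 - 2 ^ r :: complex) \<noteq> 0" using \<open>\<not> r \<ge> 2\<close> by (cases "r = 0") (auto simp: not_le less_2_cases_iff)
  ultimately have "poly f x = 0" for x
    using binary_form_eq_poly[OF assms(2), of x] by simp
  then show False using assms(3) poly_all_0_iff_0 by blast
qed

lemma multiple_root_imp_long_decomposition:
  assumes f: "f \<noteq> 0" "degree f \<le> r" "annihilates f h r d"
    and mr: "has_multiple_root r (coeff f)"
    and free: "apolar_free_below r d h" and rd: "r \<le> d"
    and dec: "sum_of_powers d R h"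
  shows "R \<ge> d - r + 2"
proof (rule ccontr)
  assume "\<not> R \<ge> d - r + 2"
  then have R: "R \<le> d - r + 1" by simp
  have r: "r \<ge> 2" by (rule has_multiple_root_imp_degree_ge_2[OF mr f(2,1)])
  then have "d > 0" using rd by simp
  then obtain S w v where fin: "finite S" and card: "card S + (if v = 0 then 0 else 1) \<le> R"
    and L: "\<And>p. degree p \<le> d \<Longrightarrow> seq_functional h p = (\<Sum>x\<in>S. w x * poly p x) + v * coeff p d"
    using sum_of_powers_nodes[OF dec] by blast
  have Lf: "(\<Sum>x\<in>S. w x * (poly f x * poly q x)) + v * coeff (f * q) d = 0" if "degree q + r \<le> d" for q
  proof -
    have "degree (f * q) \<le> d" using degree_mult_le[of f q] that f(2) by linarith
    then show ?thesis using L[of "f * q"] f(3) that unfolding annihilates_def by simp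
  qed
  have deg_prod: "degree (\<Prod>y\<in>T. [:-y, 1:]) = card T" for T :: "complex set"
    by (simp add: degree_prod_eq_sum_degree)
  have root: "w x * poly f x = 0" if x: "x \<in> S" for x
  proof -
    \<comment> \<open>This \<open>q\<close> isolates the node \<open>x\<close>; the bound on
      \<open>R\<close> keeps its degree within \<open>d - r\<close>.\<close>
    define q where "q = (\<Prod>y\<in>S - {x}. [:-y, 1:])"
    have dq: "degree q = card S - 1" unfolding q_def deg_prod using x fin by simp
    have "card S \<ge> 1" using x fin by (metis One_nat_def Suc_leI card_gt_0_iff empty_iff)
    then have "degree q + r \<le> d" using dq card R rd by auto
    \<comment> \<open>A node at infinity uses up one term, which lowers the degree of
      \<open>f q\<close> below \<open>d\<close>.\<close>
    moreover have "v * coeff (f * q) d = 0"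
    proof (cases "v = 0")
      case False
      then have "degree (f * q) < d" 
        using degree_mult_le[of f q] dq card R rd f(2) \<open>card S \<ge> 1\<close> by simp
      then show ?thesis by (simp add: coeff_eq_0)
    qed simp
    moreover have "poly q y = 0" if "y \<in> S - {x}" for y
      unfolding q_def poly_prod using that fin by auto
    then have "(\<Sum>y\<in>S. w y * (poly f y * poly q y)) = w x * (poly f x * poly q x)"
      using fin x by (subst sum.remove[of S x]) auto
    moreover have "poly q x \<noteq> 0" unfolding q_def poly_prod using fin by auto
    ultimately show ?thesis using Lf[of q] by auto
  qed
  have inf: "v * coeff f r = 0"
  proof (cases "v = 0")
    case False
    \<comment> \<open>Monic of degree exactly \<open>d - r\<close> and zero on \<open>S\<close>, so
      that \<open>f q\<close> has \<open>coeff f r\<close> in degree \<open>d\<close>.\<close>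
    define q where "q = monom 1 (d - r - card S) * (\<Prod>y\<in>S. [:-y, 1:])"
    have q0: "(\<Prod>y\<in>S. [:-y, 1:]) \<noteq> 0" by (simp add: fin)
    have dq: "degree q = d - r"
      unfolding q_def using q0 card R False by (subst degree_mult_eq) (auto simp: deg_prod degree_monom_eq)
    have lq: "lead_coeff q = 1"
      unfolding q_def lead_coeff_mult lead_coeff_prod by (simp add: degree_monom_eq)
    have "poly q y = 0" if "y \<in> S" for y
      unfolding q_def poly_mult poly_prod using that fin by auto
    then have "v * coeff (f * q) d = 0" using Lf[of q] dq rd by simp
    moreover have "coeff (f * q) d = coeff f r"
    proof (cases "degree f = r")
      case True
      then show ?thesis using coeff_mult_degree_sum[of f q] dq lq rd by simp
    next
      case False
      then have "degree f < r" using f(2) by simp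
      moreover from this have "degree (f * q) < d" using degree_mult_le[of f q] dq rd by linarith
      ultimately show ?thesis by (simp add: coeff_eq_0)
    qed
    ultimately show ?thesis by simp
  qed simp
  obtain \<alpha> \<beta> g where g: "\<And>x y. binary_form r (coeff f) x y = (\<beta> * x - \<alpha> * y)\<^sup>2 * binary_form (r - 2) g x y"
    using mr unfolding has_multiple_root_def by blast
  \<comment> \<open>The values of \<open>g\<close> beyond \<open>r - 2\<close> are cut off to obtain
    a polynomial; \<open>e\<close> is then \<open>f\<close> with one of the two equal linear factors
    removed.\<close>
  define G where "G = (\<Sum>j\<le>r - 2. monom (g j) j)"
  have cG: "coeff G j = (if j \<le> r - 2 then g j else 0)" for j by (simp add: G_def coeff_sum)
  have dG: "degree G \<le> r - 2" by (rule degree_le) (simp add: cG)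
  have bG: "binary_form (r - 2) g x y = binary_form (r - 2) (coeff G) x y" for x y
    by (rule binary_form_cong) (simp add: cG)
  define e where "e = [:\<beta>, -\<alpha>:] * G"
  have "degree e \<le> degree [:\<beta>, -\<alpha>:] + degree G" unfolding e_def by (rule degree_mult_le)
  also have "\<dots> \<le> 1 + (r - 2)" using dG by (intro add_mono) auto
  finally have de: "degree e \<le> r - 1" using r by simp
  have be: "binary_form (r - 1) (coeff e) x y = (\<beta> * x - \<alpha> * y) * binary_form (r - 2) g x y" for x y
  proof -
    have "r - 1 = Suc 0 + (r - 2)" using r by simp
    then show ?thesis unfolding e_def
      by (simp only:) (subst binary_form_mult, auto simp: dG bG binary_form_linear simp del: mult_pCons_left)
  qed
  have zero: "binary_form (r - 1) (coeff e) x y = 0" if "binary_form r (coeff f) x y = 0" for x y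
    using that unfolding g be by auto
  have "annihilates e h r (d + 1)"
    unfolding annihilates_def
  proof (intro allI impI)
    fix q :: "complex poly" assume q: "degree q + r \<le> d + 1"
    have "degree (e * q) \<le> d" using degree_mult_le[of e q] de q r by linarith
    then have "seq_functional h (e * q) = (\<Sum>x\<in>S. w x * poly (e * q) x) + v * coeff (e * q) d" by (rule L)
    also have "(\<Sum>x\<in>S. w x * poly (e * q) x) = 0"
    proof (rule sum.neutral, rule ballI)
      fix x assume "x \<in> S"
      then have "w x = 0 \<or> poly e x = 0"
        using root[of x] zero[of 1 x] binary_form_eq_poly[OF f(2), of x] binary_form_eq_poly[OF de, of x] by auto
      then show "w x * poly (e * q) x = 0" by auto
    qed
    also have "v * coeff (e * q) d = 0"
    proof (cases "v = 0")
      case False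
      \<comment> \<open>At infinity, the point \<open>(0, 1)\<close>, a form takes its top
        coefficient; a zero of \<open>f\<close> there is one of \<open>e\<close>.\<close>
      have top: "binary_form k c 0 1 = c k" for k and c :: "nat \<Rightarrow> complex"
      proof -
        have "{..k} = insert k {..<k}" by auto
        then show ?thesis by (simp add: binary_form_def power_0_left)
      qed
      have "coeff e (r - 1) = 0" using zero[of 0 1] inf False by (simp add: top)
      show ?thesis
      proof (cases "e = 0")
        case e0: False
        then have "degree e < r - 1" using \<open>coeff e (r - 1) = 0\<close> de
          by (metis leading_coeff_0_iff le_neq_implies_less)
        then have "degree (e * q) < d" using degree_mult_le[of e q] q by linarith
        then show ?thesis by (simp add: coeff_eq_0)
      qed simp
    qed simp
    finally show "seq_functional h (e * q) = 0" by simp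
  qed
  moreover have "degree e < r" using de r by linarith
  ultimately have "e = 0" using free unfolding apolar_free_below_def by blast
  then have "binary_form (r - 1) (coeff e) x y = 0" for x y by (simp add: binary_form_def)
  then have "binary_form r (coeff f) x y = 0" for x y
    unfolding g using be[of x y] by auto
  then have "poly f x = 0" for x using binary_form_eq_poly[OF f(2), of x] by simp
  then show False using f(1) poly_all_0_iff_0 by blast
qed

section \<open>Rank of the catalecticant\<close>

text \<open>Steinitz exchange, applied to a maximal independent set of columns.\<close>

lemma (in vec_space) rank_le_card_spanning:
  assumes A: "A \<in> carrier_mat n nc" and B: "finite B" "B \<subseteq> carrier_vec n" "set (cols A) \<subseteq> span B"
  shows "rank A \<le> card B"
proof -
  let ?P = "\<lambda>T. T \<subseteq> set (cols A) \<and> lin_indpt T"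
  have "lin_indpt {}" by (simp add: lin_dep_def)
  then obtain S where S: "finite S" "maximal S ?P"
    using maximal_exists_superset[of "set (cols A)" ?P "{}"] by auto
  then have "S \<subseteq> span B" "lin_indpt S" using B(3) by (auto simp: maximal_def)
  then obtain C :: "'a vec set" where "int (card C) \<le> int (card B) - int (card S)"
    using replacement[of S B] S(1) B(1,2) by auto
  then show ?thesis using rank_card_indpt[OF A S(2)] by simp
qed

lemma (in vec_space) vec_sum_in_span:
  fixes e :: nat
  assumes B: "B \<subseteq> carrier_vec n" and u: "\<And>t. t < e \<Longrightarrow> u t \<in> span B"
  shows "vec n (\<lambda>i. \<Sum>t<e. c t * u t $ i) \<in> span B"
  using u
proof (induction e)
  case 0
  have "vec n (\<lambda>i. \<Sum>t<0. c t * u t $ i) = 0\<^sub>v n" by auto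
  moreover have "lincomb (\<lambda>_. 0) {} \<in> span B" unfolding span_def by blast
  ultimately show ?case by (simp add: lincomb_def)
next
  case (Suc e)
  have "u e \<in> carrier_vec n" using Suc.prems[of e] B span_closed by auto
  then have "vec n (\<lambda>i. \<Sum>t<Suc e. c t * u t $ i) = vec n (\<lambda>i. \<Sum>t<e. c t * u t $ i) + c e \<cdot>\<^sub>v u e"
    by auto
  moreover have "vec n (\<lambda>i. \<Sum>t<e. c t * u t $ i) \<in> span B" using Suc by simp
  moreover have "c e \<cdot>\<^sub>v u e \<in> span B" using Suc.prems[of e] B by (intro smult_in_span) auto
  ultimately show ?case using span_add1[OF B] by simp
qed

text \<open>With \<open>e = degree g\<close>, the recurrence given by \<open>g\<close> expresses
  each column \<open>j\<close> with \<open>e \<le> j < e + s + 2 - r\<close> through the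
  \<open>e\<close> preceding ones.\<close>

lemma catalecticant_rank_le:
  assumes g: "g \<noteq> 0" "degree g < r" "annihilates g h r (2 * s + 1)" and rs: "r \<le> s + 1"
  shows "mat_rank (catalecticant s s h) < r"
proof -
  interpret vec_space "TYPE(complex)" "s + 1" .
  define e where "e = degree g"
  let ?A = "catalecticant s s h"
  have A: "?A \<in> carrier_mat (s + 1) (s + 1)" by (simp add: catalecticant_def)
  have col: "col ?A j = vec (s + 1) (\<lambda>i. h (i + j))" if "j \<le> s" for j
    using that by (auto simp: catalecticant_def)
  \<comment> \<open>The first \<open>e\<close> columns and the last \<open>r - 1 - e\<close>; the
    latter correspond to the root of \<open>g\<close> at infinity, \<open>g\<close> being read as a
    form of degree \<open>r - 1\<close>.\<close>
  define J where "J = {..<e} \<union> {e + s + 2 - r..s}"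
  define B where "B = col ?A ` J"
  have finJ: "finite J" by (simp add: J_def)
  have "card J \<le> card {..<e} + card {e + s + 2 - r..s}" unfolding J_def by (rule card_Un_le)
  also have "\<dots> < r" using g(2) rs by (simp add: e_def)
  finally have cardJ: "card J < r" .
  have B: "finite B" "B \<subseteq> carrier_vec (s + 1)" "card B < r"
  proof -
    show "finite B" unfolding B_def using finJ by (rule finite_imageI)
    have "col ?A j \<in> carrier_vec (s + 1)" for j
      by (intro carrier_vecI) (simp add: catalecticant_def)
    then show "B \<subseteq> carrier_vec (s + 1)" by (auto simp only: B_def)
    show "card B < r" unfolding B_def using card_image_le[OF finJ, of "col ?A"] cardJ by linarith
  qed
  have "col ?A j \<in> span B" if "j \<le> s" for j
    using that
  proof (induction j rule: less_induct)
    case (less j)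
    show ?case
    proof (cases "j \<in> J")
      case True
      then show ?thesis using B(2) by (intro span_mem) (auto simp: B_def)
    next
      case False
      then have j: "e \<le> j" "j < e + s + 2 - r" using less.prems by (auto simp: J_def)
      define c where "c t = - coeff g t / coeff g e" for t
      have ge: "coeff g e \<noteq> 0" using g(1) by (simp add: e_def)
      have "h (i + j) = (\<Sum>t<e. c t * h (i + (j - e + t)))" if i: "i \<le> s" for i
      proof -
        have "seq_functional h (g * monom 1 (i + j - e)) = 0"
          using g(3) i j rs g(2) unfolding annihilates_def by (simp add: degree_monom_eq)
        then have "(\<Sum>t<Suc e. coeff g t * h (i + j - e + t)) = 0"
          by (subst (asm) seq_functional_mult_monom[of _ "Suc e"]) (auto simp: e_def)
        then have "coeff g e * h (i + j) = - (\<Sum>t<e. coeff g t * h (i + j - e + t))"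
          using j(1) by (simp add: add_eq_0_iff)
        then have "h (i + j) = (\<Sum>t<e. c t * h (i + j - e + t))"
          using ge by (simp add: c_def field_simps sum_divide_distrib[symmetric] sum_negf)
        then show ?thesis using j(1) by (simp add: add.assoc)
      qed
      then have "col ?A j = vec (s + 1) (\<lambda>i. \<Sum>t<e. c t * col ?A (j - e + t) $ i)"
        using less.prems j by (auto simp: col)
      also have "\<dots> \<in> span B"
        using less j by (intro vec_sum_in_span[OF B(2)]) auto
      finally show ?thesis .
    qed
  qed
  then have "set (cols ?A) \<subseteq> span B" by (auto simp: cols_def catalecticant_def)
  then have "rank ?A \<le> card B" by (rule rank_le_card_spanning[OF A B(1,2)])
  then show ?thesis using B(3) by (simp add: mat_rank_def catalecticant_def)
qed

lemma apolar_free_below_rank: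
  assumes "mat_rank (catalecticant s s h) = r" "r \<le> s + 1"
  shows "apolar_free_below r (2 * s) h"
  using catalecticant_rank_le[of _ r h s] assms unfolding apolar_free_below_def by auto

lemma mat_rank_full_iff:
  "mat_rank (catalecticant s s h) = s + 1 \<longleftrightarrow> det (mat (s + 1) (s + 1) (\<lambda>(i, j). h (i + j))) \<noteq> 0"
proof -
  interpret vec_space "TYPE(complex)" "s + 1" .
  show ?thesis using det_rank_iff[of "catalecticant s s h"]
    by (simp add: mat_rank_def catalecticant_def)
qed

lemma kernel_poly:
  assumes f: "f \<in> mat_kernel (catalecticant (d - r) r h)" "f \<noteq> 0\<^sub>v (r + 1)" and rd: "r \<le> d"
  defines "p \<equiv> \<Sum>j\<le>r. monom (f $ j) j"
  shows "p \<noteq> 0" "degree p \<le> r" "annihilates p h r d" "\<And>j. j \<le> r \<Longrightarrow> coeff p j = f $ j"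
proof -
  have A: "catalecticant (d - r) r h \<in> carrier_mat (d - r + 1) (r + 1)" by (simp add: catalecticant_def)
  have fc: "f \<in> carrier_vec (r + 1)" and ker: "catalecticant (d - r) r h *\<^sub>v f = 0\<^sub>v (d - r + 1)"
    using mat_kernelD[OF A f(1)] by auto
  have cp: "coeff p j = (if j \<le> r then f $ j else 0)" for j by (simp add: p_def coeff_sum)
  then show "\<And>j. j \<le> r \<Longrightarrow> coeff p j = f $ j" by simp
  show dp: "degree p \<le> r" by (rule degree_le) (simp add: cp)
  show "p \<noteq> 0"
  proof
    assume "p = 0"
    then have "f $ j = 0" if "j \<le> r" for j using cp[of j] that by simp
    then have "f = 0\<^sub>v (r + 1)" using fc by (intro eq_vecI) auto
    then show False using f(2) by contradiction
  qed
  show "annihilates p h r d"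
  proof (rule annihilatesI[of _ _ _ _ "monom 1 1"])
    fix i assume i: "i + r \<le> d"
    have "(\<Sum>j<Suc r. h (i + j) * f $ j) = (catalecticant (d - r) r h *\<^sub>v f) $ i"
      using i fc by (auto simp: catalecticant_def scalar_prod_def lessThan_atLeast0 simp del: sum.op_ivl_Suc)
    also have "\<dots> = 0" using i by (simp add: ker)
    also have "(\<Sum>j<Suc r. h (i + j) * f $ j) = (\<Sum>j<Suc r. coeff p j * h (i + j))"
      by (intro sum.cong) (auto simp: cp)
    finally have "(\<Sum>j<Suc r. coeff p j * h (i + j)) = 0" .
    then show "seq_functional h (p * monom 1 1 ^ i) = 0"
      using dp by (simp add: monom_power seq_functional_mult_monom[of _ "Suc r"] del: sum.lessThan_Suc)
  qed (simp add: degree_monom_eq)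
qed

section \<open>Tensors and their ranks\<close>

lemma sum_list_valid_idx_le:
  assumes "is \<in> valid_idx m n"
  shows "sum_list is \<le> (n - 1) * m"
proof -
  have "sum_list (map id is) \<le> sum_list (map (\<lambda>_. n - 1) is)"
    by (rule sum_list_mono) (use assms in \<open>auto simp: valid_idx_def\<close>)
  then show ?thesis using assms by (simp add: valid_idx_def sum_list_triv mult.commute)
qed

text \<open>Filling the indices greedily reaches every sum; hence a Hankel tensor determines its
  associated vector.\<close>

lemma ex_valid_idx_sum_list:
  assumes "n > 0" "i \<le> (n - 1) * m"
  shows "\<exists>is\<in>valid_idx m n. sum_list is = i"
  using assms(2)
proof (induction m arbitrary: i)
  case 0
  then show ?case by (auto simp: valid_idx_def)
next
  case (Suc m)
  have "i - min i (n - 1) \<le> (n - 1) * m" using Suc.prems by (auto simp: min_def algebra_simps)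
  then obtain "is" where "is \<in> valid_idx m n" "sum_list is = i - min i (n - 1)" using Suc.IH by blast
  then show ?case using assms(1)
    by (intro bexI[of _ "min i (n - 1) # is"]) (auto simp: valid_idx_def min_def)
qed

lemma valid_idx_nth: "is \<in> valid_idx m n \<Longrightarrow> j < m \<Longrightarrow> is ! j < n"
  by (force simp: valid_idx_def)

lemma prod_vandermonde:
  fixes a b :: complex
  assumes "is \<in> valid_idx m n"
  shows "(\<Prod>j<m. a ^ (n - 1 - is ! j) * b ^ (is ! j)) = a ^ ((n - 1) * m - sum_list is) * b ^ sum_list is"
proof -
  have len: "length is = m" using assms by (simp add: valid_idx_def)
  have le: "is ! j \<le> n - 1" if "j < m" for j using valid_idx_nth[OF assms that] by simp
  have s: "sum_list is = (\<Sum>j<m. is ! j)"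
    by (simp add: sum_list_sum_nth len lessThan_atLeast0)
  have "(\<Sum>j<m. n - 1 - is ! j) = (\<Sum>j<m. n - 1) - (\<Sum>j<m. is ! j)"
    by (rule sum_subtractf_nat) (use le in auto)
  then show ?thesis
    unfolding prod.distrib s power_sum[symmetric] by (simp add: mult.commute)
qed

lemma vand_decomp_iff_sum_of_powers:
  assumes "is_hankel_with m n H h" "n > 0"
  shows "vand_decomp m n R H \<longleftrightarrow> sum_of_powers ((n - 1) * m) R h"
proof
  assume "vand_decomp m n R H"
  then obtain a b where ab: "\<And>is. is \<in> valid_idx m n \<Longrightarrow>
      H is = (\<Sum>k<R. \<Prod>j<m. a k ^ (n - 1 - is ! j) * b k ^ (is ! j))"
    unfolding vand_decomp_def by blast
  have "h i = (\<Sum>k<R. a k ^ ((n - 1) * m - i) * b k ^ i)" if i: "i \<le> (n - 1) * m" for i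
  proof -
    obtain "is" where ix: "is \<in> valid_idx m n" "sum_list is = i"
      using ex_valid_idx_sum_list[OF assms(2) i] by blast
    then have "h i = H is" using assms(1) by (auto simp: is_hankel_with_def)
    then show ?thesis using ab[OF ix(1)] ix(2) by (simp only: prod_vandermonde[OF ix(1)])
  qed
  then show "sum_of_powers ((n - 1) * m) R h" unfolding sum_of_powers_def by blast
next
  assume "sum_of_powers ((n - 1) * m) R h"
  then obtain a b where ab: "\<And>i. i \<le> (n - 1) * m \<Longrightarrow> h i = (\<Sum>k<R. a k ^ ((n - 1) * m - i) * b k ^ i)"
    unfolding sum_of_powers_def by blast
  have "H is = (\<Sum>k<R. \<Prod>j<m. a k ^ (n - 1 - is ! j) * b k ^ (is ! j))" if ix: "is \<in> valid_idx m n" for "is"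
    using assms(1) ix ab[OF sum_list_valid_idx_le[OF ix]]
    by (simp only: prod_vandermonde[OF ix] is_hankel_with_def)
  then show "vand_decomp m n R H" unfolding vand_decomp_def by blast
qed

lemma vand_decomp_imp_sym_decomp: "vand_decomp m n R A \<Longrightarrow> sym_decomp m n R A"
  unfolding vand_decomp_def sym_decomp_def by (auto intro: exI[of _ "\<lambda>k i. _ k ^ (n - 1 - i) * _ k ^ i"])

lemma sym_decomp_imp_cp_decomp: "sym_decomp m n R A \<Longrightarrow> cp_decomp m n R A"
  unfolding sym_decomp_def cp_decomp_def by (auto intro: exI[of _ "\<lambda>k j. _ k"])

lemma sym_decomp_mono:
  assumes "sym_decomp m n R A" "R \<le> R'" "m > 0"
  shows "sym_decomp m n R' A"
proof -
  obtain u where u: "\<And>is. is \<in> valid_idx m n \<Longrightarrow> A is = (\<Sum>k<R. \<Prod>j<m. u k (is ! j))"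
    using assms(1) unfolding sym_decomp_def by blast
  \<comment> \<open>Padding by zero vectors; the products they contribute vanish because
    \<open>m > 0\<close>.\<close>
  define u' where "u' k i = (if k < R then u k i else 0)" for k i
  have "A is = (\<Sum>k<R'. \<Prod>j<m. u' k (is ! j))" if "is \<in> valid_idx m n" for "is"
  proof -
    have "(\<Sum>k<R'. \<Prod>j<m. u' k (is ! j)) = (\<Sum>k<R. \<Prod>j<m. u' k (is ! j))"
      by (rule sum.mono_neutral_right) (use assms(2,3) in \<open>auto simp: u'_def\<close>)
    then show ?thesis using u[OF that] by (simp add: u'_def)
  qed
  then show ?thesis unfolding sym_decomp_def by blast
qed

section \<open>Limits and least ranks\<close>

lemma limit_of_const: "P A \<Longrightarrow> limit_of m n P A"
  unfolding limit_of_def by (intro exI[of _ "\<lambda>_. A"]) auto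

lemma limit_of_mono: "limit_of m n P A \<Longrightarrow> (\<And>X. P X \<Longrightarrow> Q X) \<Longrightarrow> limit_of m n Q A"
  unfolding limit_of_def by blast

lemma least_rank_le: "P R \<Longrightarrow> least_rank P \<le> enat R"
  unfolding least_rank_def by (rule INF_lower) simp

lemma le_least_rank: "(\<And>R. P R \<Longrightarrow> k \<le> R) \<Longrightarrow> enat k \<le> least_rank P"
  unfolding least_rank_def by (rule INF_greatest) simp

lemma least_rank_eqI: "P k \<Longrightarrow> (\<And>R. P R \<Longrightarrow> k \<le> R) \<Longrightarrow> least_rank P = enat k"
  by (intro antisym least_rank_le le_least_rank)

lemma least_rank_leD:
  assumes "least_rank P \<le> enat R"
  shows "\<exists>R'\<le>R. P R'"
proof (rule ccontr)
  assume "\<not> ?thesis"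
  then have "enat (Suc R) \<le> least_rank P"
    by (intro le_least_rank) (metis not_less_eq_eq)
  then show False using assms by (metis enat_ord_simps(1) not_less_eq_eq order_refl order_trans)
qed

lemma vand_rank_le_imp_sym_decomp:
  assumes "vand_rank m n X \<le> enat R" "m > 0"
  shows "sym_decomp m n R X"
  using least_rank_leD[of "\<lambda>r. vand_decomp m n r X" R] assms
    sym_decomp_mono vand_decomp_imp_sym_decomp unfolding vand_rank_def by blast

text \<open>The matrix factors through dimension \<open>R\<close>. Padded to a square matrix, the
  left factor has a zero column at index \<open>R\<close>.\<close>

lemma det_gram_eq_0:
  fixes x y :: "nat \<Rightarrow> nat \<Rightarrow> complex"
  assumes "R < k"
  shows "det (mat k k (\<lambda>(i, j). \<Sum>u<R. x i u * y u j)) = 0"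
proof -
  define P where "P = mat k k (\<lambda>(i, u). if u < R then x i u else 0)"
  define Q where "Q = mat k k (\<lambda>(u, j). y u j)"
  have P: "P \<in> carrier_mat k k" and Q: "Q \<in> carrier_mat k k" by (simp_all add: P_def Q_def)
  have "mat k k (\<lambda>(i, j). \<Sum>u<R. x i u * y u j) = P * Q"
  proof (rule eq_matI)
    fix i j assume ij: "i < dim_row (P * Q)" "j < dim_col (P * Q)"
    have "(\<Sum>u<R. x i u * y u j) = (\<Sum>u\<in>{0..<k}. (if u < R then x i u else 0) * y u j)"
      by (rule sum.mono_neutral_cong_left) (use assms in auto)
    then show "mat k k (\<lambda>(i, j). \<Sum>u<R. x i u * y u j) $$ (i, j) = (P * Q) $$ (i, j)"
      using ij by (simp add: P_def Q_def scalar_prod_def)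
  qed (simp_all add: P_def Q_def)
  moreover have "P *\<^sub>v unit_vec k R = 0\<^sub>v k"
    using assms by (intro eq_vecI) (auto simp: P_def)
  then have "det P = 0"
    unfolding det_0_iff_vec_prod_zero_field[OF P] using assms unit_vec_nonzero[of R k]
    by (intro exI[of _ "unit_vec k R"]) simp
  ultimately show ?thesis using det_mult[OF P Q] by simp
qed

lemma tendsto_det:
  fixes M :: "'b \<Rightarrow> nat \<Rightarrow> nat \<Rightarrow> complex"
  assumes "\<And>i j. i < k \<Longrightarrow> j < k \<Longrightarrow> ((\<lambda>t. M t i j) \<longlongrightarrow> L i j) F"
  shows "((\<lambda>t. det (mat k k (\<lambda>(i, j). M t i j))) \<longlongrightarrow> det (mat k k (\<lambda>(i, j). L i j))) F"
proof -
  have less: "p i < k" if "p permutes {0..<k}" "i < k" for p i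
    using permutes_in_image[OF that(1), of i] that(2) by simp
  have det: "det (mat k k (\<lambda>(i, j). N i j)) =
      (\<Sum>p | p permutes {0..<k}. signof p * (\<Prod>i = 0..<k. N i (p i)))" for N :: "nat \<Rightarrow> nat \<Rightarrow> complex"
    by (subst det_def'[of _ k]) (auto intro!: sum.cong prod.cong arg_cong2[of _ _ _ _ "(*)"] simp: less)
  show ?thesis unfolding det
    by (intro tendsto_sum tendsto_mult tendsto_const tendsto_prod assms) (auto simp: less)
qed

text \<open>Flatten the tensor to a matrix whose rows and columns are indexed by the first and the
  last \<open>m0\<close> indices, and compress it by the \<open>p i\<close> to a \<open>k \<times> k\<close> matrix.\<close>
lemma border_rank_lower_bound:
  assumes H: "is_hankel_with (2 * m0) n H h" and "n > 0"
    and p: "\<And>i. i < k \<Longrightarrow> degree (p i) \<le> (n - 1) * m0"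
    and det: "det (mat k k (\<lambda>(i, j). seq_functional h (p i * p j))) \<noteq> 0"
    and lim: "limit_of (2 * m0) n (cp_decomp (2 * m0) n R) H"
  shows "k \<le> R"
proof (rule ccontr)
  assume "\<not> k \<le> R"
  define s where "s = (n - 1) * m0"
  obtain ix where ix: "\<And>i. i \<le> s \<Longrightarrow> ix i \<in> valid_idx m0 n" "\<And>i. i \<le> s \<Longrightarrow> sum_list (ix i) = i"
    using ex_valid_idx_sum_list[OF \<open>n > 0\<close>, of _ m0] unfolding s_def by metis
  have ixx: "ix a @ ix b \<in> valid_idx (2 * m0) n" if "a \<le> s" "b \<le> s" for a b
    using ix(1)[OF that(1)] ix(1)[OF that(2)] by (auto simp: valid_idx_def)
  obtain X where X: "\<And>t. cp_decomp (2 * m0) n R (X t)"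
    and lim: "\<And>is. is \<in> valid_idx (2 * m0) n \<Longrightarrow> (\<lambda>t. X t is) \<longlonglongrightarrow> H is"
    using lim unfolding limit_of_def by blast
  \<comment> \<open>The compressed flattening of the approximating tensor
    \<open>X t\<close>.\<close>
  define M where "M t i j = (\<Sum>a\<le>s. \<Sum>b\<le>s. coeff (p i) a * coeff (p j) b * X t (ix a @ ix b))" for t i j
  have "(\<lambda>t. M t i j) \<longlonglongrightarrow> seq_functional h (p i * p j)" if ij: "i < k" "j < k" for i j
  proof -
    have "p i * p j = (\<Sum>a\<le>s. monom (coeff (p i) a) a) * (\<Sum>b\<le>s. monom (coeff (p j) b) b)"
      using p[OF ij(1)] p[OF ij(2)] by (simp add: poly_as_sum_of_monoms' s_def)
    also have "\<dots> = (\<Sum>a\<le>s. \<Sum>b\<le>s. monom (coeff (p i) a * coeff (p j) b) (a + b))"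
      by (simp add: sum_product mult_monom)
    finally have "seq_functional h (p i * p j) = (\<Sum>a\<le>s. \<Sum>b\<le>s. coeff (p i) a * coeff (p j) b * h (a + b))"
      by (simp add: seq_functional_sum seq_functional_monom)
    also have "\<dots> = (\<Sum>a\<le>s. \<Sum>b\<le>s. coeff (p i) a * coeff (p j) b * H (ix a @ ix b))"
      using H ixx ix(2) by (intro sum.cong) (auto simp: is_hankel_with_def)
    finally show ?thesis unfolding M_def
      by (simp only:) (intro tendsto_sum tendsto_mult tendsto_const lim ixx, auto)
  qed
  then have "(\<lambda>t. det (mat k k (\<lambda>(i, j). M t i j))) \<longlonglongrightarrow> det (mat k k (\<lambda>(i, j). seq_functional h (p i * p j)))"
    by (rule tendsto_det)
  moreover have "det (mat k k (\<lambda>(i, j). M t i j)) = 0" for t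
  proof -
    obtain U where U: "\<And>is. is \<in> valid_idx (2 * m0) n \<Longrightarrow> X t is = (\<Sum>u<R. \<Prod>j<2 * m0. U u j (is ! j))"
      using X[of t] unfolding cp_decomp_def by blast
    define \<alpha> where "\<alpha> u a = (\<Prod>j<m0. U u j (ix a ! j))" for u a
    define \<beta> where "\<beta> u b = (\<Prod>j<m0. U u (m0 + j) (ix b ! j))" for u b
    \<comment> \<open>A rank-one term is a product over the modes, so it factors into a row part and
      a column part.\<close>
    have split: "X t (ix a @ ix b) = (\<Sum>u<R. \<alpha> u a * \<beta> u b)" if ab: "a \<le> s" "b \<le> s" for a b
    proof -
      have len: "length (ix a) = m0" using ix(1)[OF ab(1)] by (simp add: valid_idx_def)
      have "(\<Prod>j<2 * m0. U u j ((ix a @ ix b) ! j)) = \<alpha> u a * \<beta> u b" for u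
      proof -
        have "(\<lambda>j. m0 + j) ` {..<m0} = {m0..<2 * m0}"
          using image_add_atLeastLessThan[of m0 0 m0] by (simp add: lessThan_atLeast0 mult_2)
        then have "{..<2 * m0} = {..<m0} \<union> (\<lambda>j. m0 + j) ` {..<m0}"
          by auto
        moreover have "{..<m0} \<inter> (\<lambda>j. m0 + j) ` {..<m0} = {}" by auto
        ultimately show ?thesis unfolding \<alpha>_def \<beta>_def
          by (simp add: prod.union_disjoint prod.reindex nth_append len)
      qed
      then show ?thesis using U[OF ixx[OF ab]] by simp
    qed
    have "M t i j = (\<Sum>u<R. (\<Sum>a\<le>s. coeff (p i) a * \<alpha> u a) * (\<Sum>b\<le>s. coeff (p j) b * \<beta> u b))" for i j
    proof -
      have "M t i j = (\<Sum>a\<le>s. \<Sum>b\<le>s. \<Sum>u<R. (coeff (p i) a * \<alpha> u a) * (coeff (p j) b * \<beta> u b))"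
        unfolding M_def by (intro sum.cong refl) (simp add: split sum_distrib_left mult_ac)
      also have "\<dots> = (\<Sum>a\<le>s. \<Sum>u<R. \<Sum>b\<le>s. (coeff (p i) a * \<alpha> u a) * (coeff (p j) b * \<beta> u b))"
        by (intro sum.cong refl sum.swap)
      also have "\<dots> = (\<Sum>u<R. \<Sum>a\<le>s. \<Sum>b\<le>s. (coeff (p i) a * \<alpha> u a) * (coeff (p j) b * \<beta> u b))"
        by (rule sum.swap)
      finally show ?thesis by (simp add: sum_product)
    qed
    then show ?thesis
      using \<open>\<not> k \<le> R\<close> det_gram_eq_0[of R k "\<lambda>i u. \<Sum>a\<le>s. coeff (p i) a * \<alpha> u a" "\<lambda>u j. \<Sum>b\<le>s. coeff (p j) b * \<beta> u b"]
      by simp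
  qed
  ultimately show False using det by (simp add: LIMSEQ_const_iff)
qed

lemma limit_of_vand_rank_le:
  assumes H: "is_hankel_with m n H h" and "n > 0"
    and dec: "\<And>t. sum_of_powers ((n - 1) * m) R (h' t)"
    and lim: "\<And>i. i \<le> (n - 1) * m \<Longrightarrow> (\<lambda>t::nat. h' t i) \<longlonglongrightarrow> h i"
  shows "limit_of m n (\<lambda>X. (\<exists>g. is_hankel_with m n X g) \<and> vand_rank m n X \<le> enat R) H"
  unfolding limit_of_def
proof (intro exI[of _ "\<lambda>t is. h' t (sum_list is)"] conjI allI ballI)
  fix t
  show hk: "\<exists>g. is_hankel_with m n (\<lambda>is. h' t (sum_list is)) g"
    by (intro exI[of _ "h' t"]) (simp add: is_hankel_with_def)
  have "vand_decomp m n R (\<lambda>is. h' t (sum_list is))"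
    using dec[of t] \<open>n > 0\<close> by (subst vand_decomp_iff_sum_of_powers[of _ _ _ "h' t"]) (simp_all add: is_hankel_with_def)
  then show "vand_rank m n (\<lambda>is. h' t (sum_list is)) \<le> enat R"
    unfolding vand_rank_def by (rule least_rank_le)
next
  fix "is" assume "is \<in> valid_idx m n"
  then show "(\<lambda>t. h' t (sum_list is)) \<longlonglongrightarrow> H is"
    using lim[OF sum_list_valid_idx_le] H by (simp add: is_hankel_with_def)
qed

text \<open>Limits of Vandermonde sums are limits of symmetric sums, and these are limits of cp
  sums, so all three border ranks lie between the same bounds.\<close>

lemma border_ranks_eq:
  assumes lower: "\<And>R. limit_of m n (cp_decomp m n R) H \<Longrightarrow> r \<le> R"
    and upper: "limit_of m n (\<lambda>X. (\<exists>g. is_hankel_with m n X g) \<and> vand_rank m n X \<le> enat r) H" and "m > 0"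
  shows "vand_border_rank m n H = enat r" "sym_border_rank m n H = enat r" "border_rank m n H = enat r"
proof -
  have vs: "limit_of m n (sym_decomp m n R) H"
    if "limit_of m n (\<lambda>X. (\<exists>g. is_hankel_with m n X g) \<and> vand_rank m n X \<le> enat R) H" for R
    using that by (rule limit_of_mono) (use vand_rank_le_imp_sym_decomp \<open>m > 0\<close> in blast)
  have sc: "limit_of m n (cp_decomp m n R) H" if "limit_of m n (sym_decomp m n R) H" for R
    using that by (rule limit_of_mono) (rule sym_decomp_imp_cp_decomp)
  show "vand_border_rank m n H = enat r" unfolding vand_border_rank_def
    using upper lower vs sc by (intro least_rank_eqI) blast+
  show "sym_border_rank m n H = enat r" unfolding sym_border_rank_def
    using upper lower vs sc by (intro least_rank_eqI) blast+
  show "border_rank m n H = enat r" unfolding border_rank_def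
    using upper lower vs sc by (intro least_rank_eqI) blast+
qed

text \<open>A tensor is its own constant limit, so the lower bound for the border rank also bounds
  the ranks themselves.\<close>

lemma all_ranks_eq:
  assumes H: "is_hankel_with m n H h" and "m > 0"
    and lower: "\<And>R. limit_of m n (cp_decomp m n R) H \<Longrightarrow> r \<le> R"
    and upper: "vand_decomp m n r H"
  shows "vand_rank m n H = enat r \<and> sym_rank m n H = enat r \<and> cp_rank m n H = enat r \<and>
    vand_border_rank m n H = enat r \<and> sym_border_rank m n H = enat r \<and> border_rank m n H = enat r"
proof -
  have cp: "r \<le> R" if "cp_decomp m n R H" for R
    using that by (intro lower limit_of_const)
  have vand: "vand_rank m n H = enat r" unfolding vand_rank_def
    using upper cp vand_decomp_imp_sym_decomp sym_decomp_imp_cp_decomp by (intro least_rank_eqI) blast+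
  moreover have "sym_rank m n H = enat r" unfolding sym_rank_def
    using upper cp vand_decomp_imp_sym_decomp sym_decomp_imp_cp_decomp by (intro least_rank_eqI) blast+
  moreover have "cp_rank m n H = enat r" unfolding cp_rank_def
    using upper cp vand_decomp_imp_sym_decomp sym_decomp_imp_cp_decomp by (intro least_rank_eqI) blast+
  moreover have "limit_of m n (\<lambda>X. (\<exists>g. is_hankel_with m n X g) \<and> vand_rank m n X \<le> enat r) H"
    using H vand by (intro limit_of_const) auto
  ultimately show ?thesis using border_ranks_eq[OF lower _ \<open>m > 0\<close>] by blast
qed

lemma hankel_nonsingular_if_det:
  assumes "det (mat k k (\<lambda>(i, j). h (i + j))) \<noteq> 0"
  shows "hankel_nonsingular k h"
  unfolding hankel_nonsingular_def
proof (intro allI impI)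
  let ?A = "mat k k (\<lambda>(i, j). h (i + j))"
  fix v assume v: "degree v < k" "\<forall>q. degree q < k \<longrightarrow> seq_functional h (v * q) = 0"
  have "?A *\<^sub>v vec k (coeff v) = 0\<^sub>v k"
  proof (rule eq_vecI)
    fix i assume "i < dim_vec (0\<^sub>v k :: complex vec)"
    then have i: "i < k" by simp
    have "(\<Sum>j<k. coeff v j * h (i + j)) = 0"
      using v(2) i by (simp add: degree_monom_eq flip: seq_functional_mult_monom[OF v(1)])
    then show "(?A *\<^sub>v vec k (coeff v)) $ i = 0\<^sub>v k $ i"
      using i by (simp add: scalar_prod_def lessThan_atLeast0 mult.commute)
  qed simp
  then have 0: "vec k (coeff v) = 0\<^sub>v k"
    using assms det_0_iff_vec_prod_zero_field[of ?A k] by (metis mat_carrier vec_carrier)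
  have "coeff v j = 0" for j
  proof (cases "j < k")
    case True
    then show ?thesis using arg_cong[OF 0, of "\<lambda>u. u $ j"] by simp
  qed (use v(1) in \<open>simp add: coeff_eq_0\<close>)
  then show "v = 0" by (simp add: poly_eq_iff)
qed

lemma has_multiple_root_cong:
  "(\<And>j. j \<le> r \<Longrightarrow> c j = c' j) \<Longrightarrow> has_multiple_root r c \<longleftrightarrow> has_multiple_root r c'"
  unfolding has_multiple_root_def using binary_form_cong[of r c c'] by simp

theorem theorem4p2:
  fixes m0 n :: nat and H :: tensor and h :: "nat \<Rightarrow> complex"
  assumes "m0 \<ge> 1" and "n \<ge> 2"
    and "is_hankel_with (2 * m0) n H h"
  defines "m \<equiv> 2 * m0"
  defines "d \<equiv> (n - 1) * m"
  defines "s \<equiv> d div 2"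
  defines "r \<equiv> mat_rank (catalecticant (d - s) s h)"
  shows
    "(r = s + 1 \<longrightarrow>
       vand_rank m n H = enat r \<and> sym_rank m n H = enat r \<and> cp_rank m n H = enat r \<and>
       vand_border_rank m n H = enat r \<and> sym_border_rank m n H = enat r \<and>
       border_rank m n H = enat r)
     \<and>
     (\<forall>f :: complex vec. r < s + 1 \<and> f \<in> mat_kernel (catalecticant (d - r) r h) \<and>
         f \<noteq> 0\<^sub>v (r + 1) \<longrightarrow>
       (\<not> has_multiple_root r (\<lambda>j. f $ j) \<longrightarrow>
          vand_rank m n H = enat r \<and> sym_rank m n H = enat r \<and> cp_rank m n H = enat r \<and>
          vand_border_rank m n H = enat r \<and> sym_border_rank m n H = enat r \<and>
          border_rank m n H = enat r)
       \<and>
       (has_multiple_root r (\<lambda>j. f $ j) \<longrightarrow>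
          vand_rank m n H = enat (d - r + 2) \<and> vand_rank m n H \<ge> sym_rank m n H \<and>
          sym_rank m n H \<ge> vand_border_rank m n H \<and>
          vand_border_rank m n H = enat r \<and> sym_border_rank m n H = enat r \<and>
          border_rank m n H = enat r))"
proof -
  have m: "m > 0" and n: "n > 0" using assms(1,2) by (simp_all add: m_def)
  have hankel: "is_hankel_with m n H h" using assms(3) by (simp add: m_def)
  have s: "s = (n - 1) * m0" by (simp add: s_def d_def m_def)
  then have ds: "d = 2 * s" by (simp add: d_def m_def)
  have "s > 0" using s assms(1,2) by simp
  then have d: "d > 0" using ds by simp
  have r: "mat_rank (catalecticant s s h) = r" by (simp add: r_def ds)
  have vand_iff: "vand_decomp m n R H \<longleftrightarrow> sum_of_powers d R h" for R
    unfolding d_def by (rule vand_decomp_iff_sum_of_powers[OF hankel n])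
  have lower: "k \<le> R"
    if "\<And>i. i < k \<Longrightarrow> degree (p i) \<le> s" "det (mat k k (\<lambda>(i, j). seq_functional h (p i * p j))) \<noteq> 0"
      "limit_of m n (cp_decomp m n R) H" for k R and p :: "nat \<Rightarrow> complex poly"
    using border_rank_lower_bound[OF assms(3) n that(1)[unfolded s] that(2) that(3)[unfolded m_def]] .
  show ?thesis
  proof (intro conjI impI allI; (elim conjE)?)
    assume full: "r = s + 1"
    then have det: "det (mat r r (\<lambda>(i, j). h (i + j))) \<noteq> 0"
      using mat_rank_full_iff[of s h] r by simp
    obtain S w where S: "finite S" "card S = r" "\<And>i. i \<le> 2 * r - 2 \<Longrightarrow> h i = (\<Sum>x\<in>S. w x * x ^ i)"
      using hankel_nonsingular_nodes[OF hankel_nonsingular_if_det[OF det]] full by auto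
    \<comment> \<open>The nodes represent \<open>h\<close> up to
      \<open>2 * r - 2 = 2 * s = d\<close>, that is, entirely.\<close>
    have "sum_of_powers d r h" by (rule sum_of_powersI[OF S(1,2) S(3) d]) (simp add: full ds)
    moreover have "r \<le> R" if "limit_of m n (cp_decomp m n R) H" for R
    proof (rule lower[OF _ _ that])
      show "degree (monom (1 :: complex) i) \<le> s" if "i < r" for i
        using that full by (simp add: degree_monom_eq)
      show "det (mat r r (\<lambda>(i, j). seq_functional h (monom 1 i * monom 1 j))) \<noteq> 0"
        using det by (simp add: mult_monom seq_functional_monom)
    qed
    ultimately show "vand_rank m n H = enat r" "sym_rank m n H = enat r" "cp_rank m n H = enat r"
      "vand_border_rank m n H = enat r" "sym_border_rank m n H = enat r" "border_rank m n H = enat r"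
      using all_ranks_eq[OF hankel m, of r] vand_iff by blast+
  next
    fix f :: "complex vec"
    assume rs: "r < s + 1" and f: "f \<in> mat_kernel (catalecticant (d - r) r h)" "f \<noteq> 0\<^sub>v (r + 1)"
    define p where "p = (\<Sum>j\<le>r. monom (f $ j) j)"
    have rd: "r \<le> d" "2 * r \<le> d" using rs ds by auto
    have p: "p \<noteq> 0" "degree p \<le> r" "annihilates p h r d" "\<And>j. j \<le> r \<Longrightarrow> coeff p j = f $ j"
      unfolding p_def using kernel_poly[OF f rd(1)] by auto
    have mr: "has_multiple_root r (\<lambda>j. f $ j) \<longleftrightarrow> has_multiple_root r (coeff p)"
      by (rule has_multiple_root_cong) (simp add: p(4))
    have free: "apolar_free_below r d h"
      unfolding ds using rs by (intro apolar_free_below_rank r) simp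
    obtain c g where g: "degree g = r" "lead_coeff g = 1" "annihilates g (shear_flip_seq c d h) r d"
      and free': "apolar_free_below r d (shear_flip_seq c d h)"
      and sf: "\<not> has_multiple_root r (coeff p) \<Longrightarrow> rsquarefree g"
      using monic_annihilator[OF p(1-3) free rd(1)] by blast
    let ?h = "shear_flip_seq c d h"
    have border: "r \<le> R" if "limit_of m n (cp_decomp m n R) H" for R
    proof (rule lower[OF _ _ that])
      show "degree ([:-c, 1:] ^ (s - i)) \<le> s" for i
        using degree_power_le[of "[:-c, 1:]" "s - i"] by simp
      \<comment> \<open>Products of the polynomials \<open>(X - c) ^ (s - i)\<close> give the
        entries of the transformed sequence, whose Hankel matrix of size \<open>r\<close> is
        nonsingular.\<close>
      have "mat r r (\<lambda>(i, j). ?h (i + j)) = 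
          mat r r (\<lambda>(i, j). seq_functional h ([:-c, 1:] ^ (s - i) * [:-c, 1:] ^ (s - j)))"
      proof (rule cong_mat)
        fix i j assume "i < r" "j < r"
        then have "d - (i + j) = (s - i) + (s - j)" using rs ds by linarith
        then show "(case (i, j) of (i, j) \<Rightarrow> ?h (i + j)) =
            (case (i, j) of (i, j) \<Rightarrow> seq_functional h ([:-c, 1:] ^ (s - i) * [:-c, 1:] ^ (s - j)))"
          by (simp add: shear_flip_seq_def power_add)
      qed simp_all
      then show "det (mat r r (\<lambda>(i, j). seq_functional h ([:-c, 1:] ^ (s - i) * [:-c, 1:] ^ (s - j)))) \<noteq> 0"
        using det_hankel_nonzero[OF hankel_nonsingular_if_apolar_free[OF g free']] by simp
    qed
    {
      assume "\<not> has_multiple_root r (\<lambda>j. f $ j)"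
      then have "rsquarefree g" using mr sf by blast
      then obtain w where w: "\<And>p. degree p \<le> d \<Longrightarrow>
          seq_functional ?h p = (\<Sum>x | poly g x = 0. w x * poly p x)"
        using annihilator_quadrature[of g ?h d] g by auto
      have "?h i = (\<Sum>x | poly g x = 0. w x * x ^ i)" if "i \<le> d" for i
        using w[of "monom 1 i"] that by (simp add: degree_monom_eq seq_functional_monom poly_monom)
      moreover have "finite {x. poly g x = 0}" using g(2) by (intro poly_roots_finite) auto
      \<comment> \<open>The \<open>r\<close> simple roots of \<open>g\<close> are the nodes, and the
        coordinate change preserves the number of terms.\<close>
      ultimately have "sum_of_powers d r ?h"
        using rsquarefree_card_roots[OF \<open>rsquarefree g\<close>] g(1) d by (intro sum_of_powersI) auto
      then have "vand_decomp m n r H" unfolding vand_iff by (rule sum_of_powers_shear_flipD)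
      then show "vand_rank m n H = enat r" "sym_rank m n H = enat r" "cp_rank m n H = enat r"
        "vand_border_rank m n H = enat r" "sym_border_rank m n H = enat r" "border_rank m n H = enat r"
        using all_ranks_eq[OF hankel m border] by blast+
    next
      assume "has_multiple_root r (\<lambda>j. f $ j)"
      then have mrp: "has_multiple_root r (coeff p)" using mr by simp
      have "r > 0" using has_multiple_root_imp_degree_ge_2[OF mrp p(2,1)] by simp
      then obtain h' where h': "\<And>t::nat. \<exists>S w. finite S \<and> card S = r \<and> (\<forall>i\<le>d. h' t i = (\<Sum>x\<in>S. w x * x ^ i))"
        "\<And>i. i \<le> d \<Longrightarrow> (\<lambda>t. h' t i) \<longlonglongrightarrow> ?h i"
        using squarefree_approximation[OF g(1,2) _ g(3)] by blast
      have "limit_of m n (\<lambda>X. (\<exists>g. is_hankel_with m n X g) \<and> vand_rank m n X \<le> enat r) H"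
      \<comment> \<open>The approximations live in the changed coordinates. Changing back is linear,
        hence continuous, and keeps the number of terms.\<close>
      proof (rule limit_of_vand_rank_le[OF hankel n, of _ "\<lambda>t. unshear_flip_seq c d (h' t)"], fold d_def)
        fix t
        have "sum_of_powers d r (h' t)" using h'(1)[of t] d by (auto intro: sum_of_powersI)
        then show "sum_of_powers d r (unshear_flip_seq c d (h' t))" by (rule sum_of_powers_unshear_flip)
      next
        fix i assume i: "i \<le> d"
        have "(\<lambda>t. unshear_flip_seq c d (h' t) i) \<longlonglongrightarrow> unshear_flip_seq c d ?h i"
          unfolding unshear_flip_seq_def by (intro tendsto_intros h'(2)) simp
        then show "(\<lambda>t. unshear_flip_seq c d (h' t) i) \<longlonglongrightarrow> h i"
          by (simp add: unshear_flip_shear_flip[OF i])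
      qed
      note borders = border_ranks_eq[OF border this m]
      then show vb: "vand_border_rank m n H = enat r" and "sym_border_rank m n H = enat r"
        "border_rank m n H = enat r" by blast+
      have "sum_of_powers d (d - r + 2) ?h"
        by (rule sum_of_powers_complement[OF g free' rd(2) d])
      then have dec: "vand_decomp m n (d - r + 2) H"
        unfolding vand_iff by (rule sum_of_powers_shear_flipD)
      then show vr: "vand_rank m n H = enat (d - r + 2)"
        unfolding vand_rank_def vand_iff
        by (intro least_rank_eqI multiple_root_imp_long_decomposition[OF p(1-3) mrp free rd(1)])
      show "vand_rank m n H \<ge> sym_rank m n H"
        unfolding vr sym_rank_def by (intro least_rank_le vand_decomp_imp_sym_decomp dec)
      \<comment> \<open>The Vandermonde border rank is already known to be \<open>r\<close>, which
        bounds the length of every symmetric decomposition from below.\<close>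
      show "sym_rank m n H \<ge> vand_border_rank m n H"
        unfolding vb sym_rank_def
        by (intro le_least_rank border limit_of_const) (rule sym_decomp_imp_cp_decomp)
    }
  qed
qed

end
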